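(* Let $\mathcal X,\mathcal Y$ be finite sets and let $P_{XY}$ (hypothesis $H_0$) and $P_{\bar X\bar Y}$ (hypothesis $H_1$) be probability measures on $\mathcal X\times\mathcal Y$ with $\operatorname{supp}(P_{\bar X\bar Y})=\operatorname{supp}(P_{XY})=\mathcal X\times\mathcal Y$. Let $K\ge1$ be an integer and assume that the total exchange rate is zero, that is, the $K$-round codes used satisfy $$\sum_{k=1}^K\log|f_{[k]}|+\sum_{k=1}^K\log|g_{[k]}|=o(n).$$ Then for every $0<\epsilon<1$ the optimal error exponent of the Type II error probability is $$\lim_{n\to\infty}-\frac1n\log\beta_n(R=0,\epsilon\,|\,K)\ =\ \min_{(\tilde X,\tilde Y)\in\mathscr L_0(X,Y)}\mathcal D\big(P_{\tilde X\tilde Y}\,\|\,P_{\bar X\bar Y}\big),$$ where $\mathscr L_0(X,Y)=\{(\tilde X,\tilde Y):\ P_{\tilde X}=P_X,\ P_{\tilde Y}=P_Y\}$ is the set of pairs on $\mathcal X\times\mathcal Y$ having the same marginals as $P_{XY}$.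
   Context: All logarithms and exponentials are in base 2; $\mathcal D(\cdot\|\cdot)$ is Kullback–Leibler divergence. Collaborative hypothesis testing. Node $A$ observes $X^n$ and node $B$ observes $Y^n$, where $(X_i,Y_i)_{i=1}^n$ are i.i.d. with law $P_{XY}$ under $H_0$ and $P_{\bar X\bar Y}$ under $H_1$. A $K$-round code of blocklength $n$ consists of encoders, for $k=1,\dots,K$, $$f_{[k]}:\mathcal X^n\times\prod_{i=1}^{k-1}\{1,\dots,|g_{[i]}|\}\to\{1,\dots,|f_{[k]}|\},\qquad g_{[k]}:\mathcal Y^n\times\prod_{i=1}^{k}\{1,\dots,|f_{[i]}|\}\to\{1,\dots,|g_{[k]}|\},$$ and a decision map $\phi:\mathcal X^n\times\prod_{i=1}^K\{1,\dots,|g_{[i]}|\}\to\{0,1\}$, where $|f_{[k]}|,|g_{[k]}|\ge1$ denote the sizes of the ranges. The messages are produced successively: $f_{[1]}$ is evaluated at $X^n$, then $g_{[1]}$ at $Y^n$ and the message of $f_{[1]}$, then $f_{[2]}$ at $X^n$ and the message of $g_{[1]}$, and so on. The error probabilities are $$\alpha_n=\Pr[\phi(X^n,g_{[1:K]})=1\mid (X_i,Y_i)\text{ i.i.d. }\sim P_{XY}],\qquad \beta_n=\Pr[\phi(X^n,g_{[1:K]})=0\mid (X_i,Y_i)\text{ i.i.d. }\sim P_{\bar X\bar Y}],$$ where $g_{[1:K]}$ denotes the tuple of all messages sent by node $B$. Meaning of the conclusion: writing $E_0$ for the right-hand side, (i) there is a sequence (in $n$) of $K$-round codes satisfying the $o(n)$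 constraint, with $\alpha_n\le\epsilon$ for all sufficiently large $n$, and $\lim_{n\to\infty}-\frac1n\log\beta_n=E_0$; and (ii) every sequence of $K$-round codes satisfying the $o(n)$ constraint with $\alpha_n\le\epsilon$ for all sufficiently large $n$ has $\limsup_{n\to\infty}-\frac1n\log\beta_n\le E_0$. *)

theory Defs
  imports "HOL-Probability.Probability"
begin

text \<open>
  A word of length \<open>n\<close> is a list of length \<open>n\<close>. A message tuple is a list of natural numbers whose
  entry at position \<open>i\<close>, the message of round \<open>i + 1\<close>, lies in \<open>{1..s (i + 1)}\<close>.
\<close>

definition words :: "nat \<Rightarrow> 'a list set" where
  "words n = {xs. length xs = n}"

definition message_tuples :: "(nat \<Rightarrow> nat) \<Rightarrow> nat \<Rightarrow> nat list set" where
  "message_tuples s m = {ms. length ms = m \<and> (\<forall>i<m. ms ! i \<in> {1..s (Suc i)})}"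

text \<open>
  Rounds are numbered from 1. The sizes are those of the message sets into which the encoders map;
  only the values for rounds \<open>1..K\<close> of a \<open>K\<close>-round code matter.
\<close>

record ('x, 'y) code =
  fsize :: "nat \<Rightarrow> nat"
  gsize :: "nat \<Rightarrow> nat"
  fenc :: "nat \<Rightarrow> 'x list \<times> nat list \<Rightarrow> nat"
  genc :: "nat \<Rightarrow> 'y list \<times> nat list \<Rightarrow> nat"
  decide :: "'x list \<times> nat list \<Rightarrow> nat"

definition is_code :: "nat \<Rightarrow> nat \<Rightarrow> ('x, 'y) code \<Rightarrow> bool" where
  "is_code K n C \<longleftrightarrow>
     (\<forall>k\<in>{1..K}. 1 \<le> fsize C k \<and> 1 \<le> gsize C k \<and>
        fenc C k \<in> words n \<times> message_tuples (gsize C) (k - 1) \<rightarrow> {1..fsize C k} \<and>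
        genc C k \<in> words n \<times> message_tuples (fsize C) k \<rightarrow> {1..gsize C k}) \<and>
     decide C \<in> words n \<times> message_tuples (gsize C) K \<rightarrow> {0, 1}"

text \<open>The messages sent by node A and by node B during the first \<open>k\<close> rounds.\<close>

primrec transcript :: "('x, 'y) code \<Rightarrow> 'x list \<Rightarrow> 'y list \<Rightarrow> nat \<Rightarrow> nat list \<times> nat list" where
  "transcript C xs ys 0 = ([], [])"
| "transcript C xs ys (Suc k) =
     (let (fs, gs) = transcript C xs ys k;
          fs' = fs @ [fenc C (Suc k) (xs, gs)]
      in (fs', gs @ [genc C (Suc k) (ys, fs')]))"

definition decision :: "nat \<Rightarrow> ('x, 'y) code \<Rightarrow> ('x \<times> 'y) list \<Rightarrow> nat" where
  "decision K C zs =
     (let xs = map fst zs; ys = map snd zs in decide C (xs, snd (transcript C xs ys K)))"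

definition type1_error :: "nat \<Rightarrow> ('x \<times> 'y) pmf \<Rightarrow> nat \<Rightarrow> ('x, 'y) code \<Rightarrow> real" where
  "type1_error K P n C = measure_pmf.prob (replicate_pmf n P) {zs. decision K C zs = 1}"

definition type2_error :: "nat \<Rightarrow> ('x \<times> 'y) pmf \<Rightarrow> nat \<Rightarrow> ('x, 'y) code \<Rightarrow> real" where
  "type2_error K Q n C = measure_pmf.prob (replicate_pmf n Q) {zs. decision K C zs = 0}"

text \<open>
  The exponent is extended real, since \<open>log 2 0 = 0\<close> in HOL, while an error probability 0 has
  exponent \<open>\<infinity>\<close>.
\<close>

definition error_exponent :: "nat \<Rightarrow> real \<Rightarrow> ereal" where
  "error_exponent n \<beta> = (if \<beta> = 0 then \<infinity> else ereal (- (1 / real n) * log 2 \<beta>))"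

definition zero_rate_codes :: "nat \<Rightarrow> (nat \<Rightarrow> ('x, 'y) code) \<Rightarrow> bool" where
  "zero_rate_codes K C \<longleftrightarrow> (\<forall>n. is_code K n (C n)) \<and>
     (\<lambda>n. (\<Sum>k=1..K. log 2 (real (fsize (C n) k))) + (\<Sum>k=1..K. log 2 (real (gsize (C n) k))))
       \<in> o(\<lambda>n. real n)"

definition optimal_zero_rate_exponent ::
    "('x \<times> 'y) pmf \<Rightarrow> ('x \<times> 'y) pmf \<Rightarrow> nat \<Rightarrow> real \<Rightarrow> ereal \<Rightarrow> bool" where
  "optimal_zero_rate_exponent P Q K \<epsilon> E \<longleftrightarrow>
     (\<exists>C. zero_rate_codes K C \<and> (\<forall>\<^sub>F n in sequentially. type1_error K P n (C n) \<le> \<epsilon>) \<and>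
        (\<lambda>n. error_exponent n (type2_error K Q n (C n))) \<longlonglongrightarrow> E) \<and>
     (\<forall>C. zero_rate_codes K C \<longrightarrow> (\<forall>\<^sub>F n in sequentially. type1_error K P n (C n) \<le> \<epsilon>) \<longrightarrow>
        limsup (\<lambda>n. error_exponent n (type2_error K Q n (C n))) \<le> E)"

text \<open>
  \<open>kl_div P Q\<close> is the divergence of \<open>P\<close> from \<open>Q\<close> in bits; the library constant takes the
  reference measure \<open>Q\<close> first.
\<close>

definition kl_div :: "'a pmf \<Rightarrow> 'a pmf \<Rightarrow> real" where
  "kl_div P Q = KL_divergence 2 (measure_pmf Q) (measure_pmf P)"

lemma kl_div_eq_sum:
  fixes P Q :: "'a :: finite pmf"
  assumes "set_pmf Q = UNIV"
  shows "kl_div P Q = (\<Sum>z\<in>UNIV. pmf P z * log 2 (pmf P z / pmf Q z))"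
proof -
  interpret sigma_finite_measure "count_space (UNIV :: 'a set)"
    by (simp add: sigma_finite_measure_count_space_finite)
  have pos: "pmf Q z \<noteq> 0" for z
    using assms by (simp add: set_pmf_eq) blast
  have "KL_divergence 2 (density (count_space UNIV) (\<lambda>z. ennreal (pmf Q z)))
          (density (count_space UNIV) (\<lambda>z. ennreal (pmf P z)))
        = (\<integral>z. pmf P z * log 2 (pmf P z / pmf Q z) \<partial>count_space UNIV)"
    by (rule KL_density_density) (auto simp: pos AE_count_space)
  then show ?thesis
    by (simp add: kl_div_def measure_pmf_eq_density lebesgue_integral_count_space_finite)
qed

definition same_marginals :: "('x \<times> 'y) pmf \<Rightarrow> ('x \<times> 'y) pmf set" where
  "same_marginals P =
     {W. map_pmf fst W = map_pmf fst P \<and> map_pmf snd W = map_pmf snd P}"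

end

theory Submission
  imports Defs "HOL-Real_Asymp.Real_Asymp"
begin

text \<open>
  Converse: the words on which a code accepts \<open>H\<^sub>0\<close> form a union of at most
  \<open>N = (\<Prod>k. |f\<^sub>k|) (\<Prod>k. |g\<^sub>k|)\<close> rectangles \<open>A \<times> B\<close>, so one of them has probability at least
  \<open>(1 - \<epsilon>) / N\<close> under \<open>P\<close>, and so have \<open>A\<close> and \<open>B\<close> under the marginals. A reverse
  Hoelder inequality with a large exponent \<open>s\<close>, whose limit for \<open>s \<rightarrow> \<infinity>\<close> is the Gibbs variational
  principle, has constant \<open>2\<close> to the power \<open>- (E + \<eta>)\<close> and tensorises. It gives
  \<open>Q\<^sup>n (A \<times> B) \<ge> 2 powr (- n (E + \<eta>)) * (P\<^sub>X\<^sup>n A * P\<^sub>Y\<^sup>n B) ^ s\<close>, where the last factor is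
  subexponential. No blowing-up argument is needed.

  Achievability: the minimiser \<open>W\<close> has full support, so stationarity along 4-cycles makes
  \<open>log (W / Q)\<close> a sum of a function of \<open>x\<close> and a function of \<open>y\<close>. Each node tests whether the
  empirical sum of its function is almost as large as its mean under \<open>P\<close>. Chebyshev's inequality
  bounds the first error, Markov's inequality for the likelihood ratio the second.
\<close>

section \<open>A reverse Hoelder inequality and its tensorisation\<close>

lemma prob_eq_pmf_map: "measure_pmf.prob M S = pmf (map_pmf (\<lambda>x. x \<in> S) M) True"
  by (simp add: pmf_map vimage_def)

lemma prob_replicate_0: "measure_pmf.prob (replicate_pmf 0 P) S = of_bool ([] \<in> S)"
  by (simp add: indicator_def)

text \<open>Conditioning on the first letter. This recursion drives the later inductions on the
  block length.\<close>

lemma prob_replicate_Suc: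
  fixes P :: "'a :: finite pmf"
  shows "measure_pmf.prob (replicate_pmf (Suc n) P) S
    = (\<Sum>z\<in>UNIV. pmf P z * measure_pmf.prob (replicate_pmf n P) {zs. z # zs \<in> S})"
proof -
  have "measure_pmf.prob (replicate_pmf (Suc n) P) S
    = pmf (bind_pmf P (\<lambda>z. map_pmf (\<lambda>zs. z # zs \<in> S) (replicate_pmf n P))) True"
    unfolding prob_eq_pmf_map replicate_pmf.simps map_bind_pmf map_return_pmf
    by (simp only: map_pmf_def)
  also have "\<dots> = (\<Sum>z\<in>UNIV. pmf P z * measure_pmf.prob (replicate_pmf n P) {zs. z # zs \<in> S})"
    unfolding pmf_bind
    by (subst integral_measure_pmf_real[of UNIV])
      (auto simp: prob_eq_pmf_map[of "replicate_pmf n P"] mult.commute)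
  finally show ?thesis .
qed

lemma sum_pmf_UNIV: "(\<Sum>x\<in>UNIV. pmf (P :: 'a :: finite pmf) x) = 1"
  using sum_pmf_eq_1[of UNIV P] by simp

lemma sum_map_pmf:
  fixes W :: "'a :: finite pmf" and f :: "'b :: finite \<Rightarrow> real"
  shows "(\<Sum>z\<in>UNIV. pmf W z * f (h z)) = (\<Sum>x\<in>UNIV. pmf (map_pmf h W) x * f x)"
proof -
  have "measure_pmf.expectation W (\<lambda>z. f (h z)) = measure_pmf.expectation (map_pmf h W) f"
    by simp
  then show ?thesis
    by (subst (asm) (1 2) integral_measure_pmf_real[of UNIV]) (auto simp: mult.commute)
qed

text \<open>A separated function sees only the marginals of \<open>W\<close>, so its mean is the
  same under all laws in \<open>same_marginals P\<close>.\<close>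

lemma sum_pmf_additive:
  fixes W :: "('x :: finite \<times> 'y :: finite) pmf" and u :: "'x \<Rightarrow> real" and v :: "'y \<Rightarrow> real"
  shows "(\<Sum>z\<in>UNIV. pmf W z * (u (fst z) + v (snd z)))
    = (\<Sum>x\<in>UNIV. pmf (map_pmf fst W) x * u x) + (\<Sum>y\<in>UNIV. pmf (map_pmf snd W) y * v y)"
  by (simp add: distrib_left sum.distrib sum_map_pmf[of W u fst] sum_map_pmf[of W v snd])

lemma replicate_pmf_map: "replicate_pmf n (map_pmf f P) = map_pmf (map f) (replicate_pmf n P)"
  by (induction n) (simp_all add: map_bind_pmf bind_map_pmf)

text \<open>One half of the Gibbs (Donsker-Varadhan) variational principle. With \<open>S\<close>
  the right-hand side, apply \<open>ln r \<le> r - 1\<close> to the ratio of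
  \<open>pmf Q z * u z\<close> and \<open>pmf W z * S\<close> and average under \<open>W\<close>;
  points where \<open>W\<close> vanishes contribute 0 on the left. The factor \<open>ln 2\<close>
  turns bits into nats.\<close>

lemma gibbs_inequality:
  fixes Q W :: "'a :: finite pmf" and u :: "'a \<Rightarrow> real"
  assumes Q: "set_pmf Q = UNIV" and u: "\<And>z. u z > 0"
  shows "exp ((\<Sum>z\<in>UNIV. pmf W z * ln (u z)) - ln 2 * kl_div W Q) \<le> (\<Sum>z\<in>UNIV. pmf Q z * u z)"
proof -
  define S where "S = (\<Sum>z\<in>UNIV. pmf Q z * u z)"
  have q: "pmf Q z > 0" for z
    using Q by (simp add: pmf_positive)
  have S: "S > 0"
    unfolding S_def by (rule sum_pos) (auto simp: q u)
  have "pmf W z * (ln (u z) - ln 2 * log 2 (pmf W z / pmf Q z) - ln S) \<le> pmf Q z * u z / S - pmf W z" for z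
  proof (cases "pmf W z = 0")
    case True
    then show ?thesis using q[of z] u[of z] S by simp
  next
    case False
    then have w: "pmf W z > 0"
      by (simp add: pmf_pos)
    have "ln (u z) - ln 2 * log 2 (pmf W z / pmf Q z) - ln S = ln (pmf Q z * u z / (pmf W z * S))"
      using w q[of z] u[of z] S by (simp add: log_def ln_div ln_mult)
    also have "\<dots> \<le> pmf Q z * u z / (pmf W z * S) - 1"
      using w q[of z] u[of z] S by (intro ln_le_minus_one) simp
    finally have "pmf W z * (ln (u z) - ln 2 * log 2 (pmf W z / pmf Q z) - ln S)
        \<le> pmf W z * (pmf Q z * u z / (pmf W z * S) - 1)"
      using w by (intro mult_left_mono) auto
    also have "\<dots> = pmf Q z * u z / S - pmf W z"
      using w S by (simp add: field_simps)
    finally show ?thesis .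
  qed
  then have "(\<Sum>z\<in>UNIV. pmf W z * (ln (u z) - ln 2 * log 2 (pmf W z / pmf Q z) - ln S))
      \<le> (\<Sum>z\<in>UNIV. pmf Q z * u z / S - pmf W z)"
    by (intro sum_mono)
  also have "\<dots> = 0"
    using S by (simp add: sum_subtractf sum_pmf_UNIV flip: sum_divide_distrib S_def)
  also have "(\<Sum>z\<in>UNIV. pmf W z * (ln (u z) - ln 2 * log 2 (pmf W z / pmf Q z) - ln S))
      = (\<Sum>z\<in>UNIV. pmf W z * ln (u z)) - ln 2 * kl_div W Q - ln S"
    by (simp add: kl_div_eq_sum[OF Q] right_diff_distrib sum_subtractf sum_distrib_left
        sum_pmf_UNIV mult.left_commute flip: sum_distrib_right)
  finally have "(\<Sum>z\<in>UNIV. pmf W z * ln (u z)) - ln 2 * kl_div W Q \<le> ln S"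
    by simp
  then show ?thesis
    using S unfolding S_def[symmetric] by (simp add: ln_ge_iff)
qed

lemma kl_div_nonneg:
  fixes Q W :: "'a :: finite pmf"
  assumes Q: "set_pmf Q = UNIV"
  shows "0 \<le> kl_div W Q"
  using gibbs_inequality[OF Q, of "\<lambda>_. 1" W] by (simp add: sum_pmf_UNIV zero_le_mult_iff)

lemma mean_one_max_ge_one:
  fixes p :: "'a :: finite pmf"
  assumes "(\<Sum>x\<in>UNIV. pmf p x * a x) = 1"
  shows "\<exists>x. a x \<ge> (1::real)"
proof (rule ccontr)
  assume "\<not> ?thesis"
  then have lt: "a x < 1" for x by (simp add: not_le)
  obtain x where x: "x \<in> set_pmf p" using set_pmf_not_empty by fast
  have "(\<Sum>x\<in>UNIV. pmf p x * a x) < (\<Sum>x\<in>UNIV. pmf p x * 1)"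
    by (rule sum_strict_mono_ex1)
      (use x lt in \<open>auto intro!: mult_left_le exI[of _ x] simp: pmf_positive less_imp_le\<close>)
  then show False using assms by (simp add: sum_pmf_UNIV)
qed

text \<open>With mean 1 and weights at least \<open>m\<close>, the upper bound alone keeps every
  value above \<open>1 - \<theta> / m\<close>. The linear term of the logarithm then averages to 0,
  and only a quadratic error is left.\<close>

lemma mean_log_near_one:
  fixes p :: "'a :: finite pmf" and a :: "'a \<Rightarrow> real"
  assumes mean: "(\<Sum>x\<in>UNIV. pmf p x * a x) = 1" and le: "\<And>x. a x \<le> 1 + \<theta>"
    and m: "0 < m" "\<And>x. m \<le> pmf p x" "m \<le> 1" and \<theta>: "0 \<le> \<theta>" "\<theta> / m \<le> 1/2"
  shows "a x > 0" and "- 2 * (\<theta> / m)^2 \<le> (\<Sum>x\<in>UNIV. pmf p x * ln (a x))"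
proof -
  have near: "\<bar>a x - 1\<bar> \<le> \<theta> / m" for x
  proof -
    have "1 = pmf p x * a x + (\<Sum>y\<in>UNIV-{x}. pmf p y * a y)"
      unfolding mean[symmetric] by (rule sum.remove) auto
    also have "\<dots> \<le> pmf p x * a x + (\<Sum>y\<in>UNIV-{x}. pmf p y * (1 + \<theta>))"
      by (intro add_left_mono sum_mono mult_left_mono le) auto
    also have "(\<Sum>y\<in>UNIV-{x}. pmf p y * (1 + \<theta>)) = (1 - pmf p x) * (1 + \<theta>)"
      using sum_pmf_UNIV[of p] sum.remove[of UNIV x "pmf p"] by (simp flip: sum_distrib_right)
    finally have "pmf p x * (1 - a x) \<le> \<theta> * (1 - pmf p x)"
      by (simp add: algebra_simps)
    also have "\<dots> \<le> \<theta>" using \<theta> by (simp add: mult_left_le)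
    finally have 1: "pmf p x * (1 - a x) \<le> \<theta>" .
    have "1 - a x \<le> \<theta> / m"
    proof (cases "1 - a x \<ge> 0")
      case True
      then have "m * (1 - a x) \<le> \<theta>" using 1 mult_right_mono[OF m(2)[of x] True] by linarith
      then show ?thesis using m by (simp add: field_simps)
    next
      case False
      moreover have "0 \<le> \<theta> / m" using m \<theta> by simp
      ultimately show ?thesis by linarith
    qed
    moreover have "\<theta> \<le> \<theta> / m" using m \<theta> by (simp add: field_simps mult_left_le)
    ultimately show ?thesis using le[of x] by linarith
  qed
  show "a x > 0" using near[of x] \<theta> by linarith
  have ln: "a x - 1 - 2 * (\<theta> / m)^2 \<le> ln (a x)" for x
  proof -
    \<comment> \<open>This expansion needs a deviation of at most 1/2, which is what
      \<open>\<theta> / m \<le> 1/2\<close> provides.\<close>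
    have "\<bar>ln (1 + (a x - 1)) - (a x - 1)\<bar> \<le> 2 * (a x - 1)^2"
      using near[of x] \<theta> by (intro abs_ln_one_plus_x_minus_x_bound) linarith
    moreover have "(a x - 1)^2 \<le> (\<theta> / m)^2"
      using near[of x] by (rule power2_le_iff_abs_le[THEN iffD2, rotated]) (use m \<theta> in simp)
    ultimately show ?thesis by (simp add: abs_le_iff)
  qed
  have "- 2 * (\<theta> / m)^2 = (\<Sum>x\<in>UNIV. pmf p x * (a x - 1 - 2 * (\<theta> / m)^2))"
    using mean by (simp add: right_diff_distrib sum_subtractf sum_pmf_UNIV flip: sum_distrib_right)
  also have "\<dots> \<le> (\<Sum>x\<in>UNIV. pmf p x * ln (a x))"
    by (intro sum_mono mult_left_mono ln) auto
  finally show "- 2 * (\<theta> / m)^2 \<le> (\<Sum>x\<in>UNIV. pmf p x * ln (a x))" .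
qed

lemma pmf_lower_bound:
  fixes p :: "'a :: finite pmf"
  assumes "set_pmf p = UNIV"
  obtains m where "0 < m" "m \<le> 1" "\<And>x. m \<le> pmf p x"
proof
  show "0 < Min (range (pmf p))" using assms by (subst Min_gr_iff) (auto simp: pmf_positive)
  show le: "Min (range (pmf p)) \<le> pmf p x" for x by simp
  show "Min (range (pmf p)) \<le> 1" by (rule order_trans[OF le pmf_le_1])
qed

text \<open>Both sides are homogeneous of degree \<open>s\<close> in \<open>a\<close> and in
  \<open>b\<close>, so the two means may be normalised to 1. The exponent \<open>s\<close> is
  uniform in \<open>a\<close> and \<open>b\<close>; this is what lets the inequality tensorise with
  one constant.\<close>

lemma reverse_hoelder:
  fixes Q W :: "('x :: finite \<times> 'y :: finite) pmf" and \<eta> :: real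
  assumes Q: "set_pmf Q = UNIV" and WX: "set_pmf (map_pmf fst W) = UNIV"
    and WY: "set_pmf (map_pmf snd W) = UNIV" and \<eta>: "\<eta> > 0"
  shows "\<exists>s::nat. s > 0 \<and> (\<forall>a b. (\<forall>x. a x \<ge> 0) \<longrightarrow> (\<forall>y. b y \<ge> 0) \<longrightarrow>
    2 powr - (kl_div W Q + \<eta>) *
      ((\<Sum>x\<in>UNIV. pmf (map_pmf fst W) x * a x) * (\<Sum>y\<in>UNIV. pmf (map_pmf snd W) y * b y)) ^ s
    \<le> (\<Sum>z\<in>UNIV. pmf Q z * (a (fst z) * b (snd z)) ^ s))"
proof -
  obtain q where q: "0 < q" "\<And>z. q \<le> pmf Q z" using pmf_lower_bound[OF Q] by metis
  obtain mx where mx: "0 < mx" "mx \<le> 1" "\<And>x. mx \<le> pmf (map_pmf fst W) x"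
    using pmf_lower_bound[OF WX] by metis
  obtain my where my: "0 < my" "my \<le> 1" "\<And>y. my \<le> pmf (map_pmf snd W) y"
    using pmf_lower_bound[OF WY] by metis
  define m where "m = min mx my"
  have m: "0 < m" "m \<le> 1" "\<And>x. m \<le> pmf (map_pmf fst W) x" "\<And>y. m \<le> pmf (map_pmf snd W) y"
    using mx my by (auto simp: m_def intro: min.coboundedI1 min.coboundedI2)
  define M where "M = 1 / (q * m)"
  have M: "M > 0" using q m by (simp add: M_def)
  \<comment> \<open>The second bound keeps deviations of size \<open>M / s\<close> within the range
    of the logarithmic estimate; the third makes the total quadratic error
    \<open>4 * M^2 / s\<close> at most the slack \<open>\<eta> * ln 2\<close>.\<close>
  obtain s :: nat where s: "real s \<ge> max 1 (max (2 * M) (4 * M^2 / (\<eta> * ln 2)))"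
    using real_arch_simple by blast
  then have s1: "real s \<ge> 1" and s2: "M / s \<le> 1/2" and s3: "4 * s * (M/s)^2 \<le> \<eta> * ln 2"
    using \<eta> by (auto simp: field_simps power2_eq_square)
  \<comment> \<open>By Bernoulli, a single product \<open>a x * b y \<ge> 1 + \<theta>\<close> already contributes at least
    \<open>q * (1 + s * \<theta>) \<ge> 1\<close>. Otherwise \<open>a\<close> and \<open>b\<close> are within \<open>O(1/s)\<close> of 1, and the quadratic error
    of the logarithm, multiplied by \<open>s\<close>, still vanishes.\<close>
  define \<theta> where "\<theta> = 1 / (q * s)"
  have \<theta>: "0 \<le> \<theta>" "\<theta> / m = M / s" using q s1 by (auto simp: \<theta>_def M_def)
  have normalised: "2 powr - (kl_div W Q + \<eta>) \<le> (\<Sum>z\<in>UNIV. pmf Q z * (a (fst z) * b (snd z)) ^ s)"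
    if a: "\<And>x. a x \<ge> 0" "(\<Sum>x\<in>UNIV. pmf (map_pmf fst W) x * a x) = 1"
      and b: "\<And>y. b y \<ge> 0" "(\<Sum>y\<in>UNIV. pmf (map_pmf snd W) y * b y) = 1" for a b
  proof (cases "\<exists>x y. a x * b y \<ge> 1 + \<theta>")
    case True
    then obtain x y where xy: "a x * b y \<ge> 1 + \<theta>" by blast
    have "2 powr - (kl_div W Q + \<eta>) \<le> 2 powr 0"
      using kl_div_nonneg[OF Q, of W] \<eta> by (intro powr_mono) auto
    also have "\<dots> \<le> q * (1 + s * \<theta>)"
      using q s1 by (simp add: \<theta>_def field_simps)
    also have "\<dots> \<le> q * (1 + \<theta>) ^ s"
      using q \<theta> by (intro mult_left_mono Bernoulli_inequality) auto
    also have "\<dots> \<le> pmf Q (x, y) * (a x * b y) ^ s"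
      using q \<theta> xy by (intro mult_mono power_mono) auto
    also have "\<dots> \<le> (\<Sum>z\<in>UNIV. pmf Q z * (a (fst z) * b (snd z)) ^ s)"
      using a b by (intro member_le_sum[of "(x, y)" UNIV "\<lambda>z. pmf Q z * (a (fst z) * b (snd z)) ^ s", simplified]) auto
    finally show ?thesis .
  next
    case False
    then have lt: "a x * b y < 1 + \<theta>" for x y by (simp add: not_le)
    \<comment> \<open>Pairing with a point where the other function is at least 1 turns the bound on
      products into a bound on each factor.\<close>
    obtain x0 where x0: "a x0 \<ge> 1" using mean_one_max_ge_one[OF a(2)] by blast
    obtain y0 where y0: "b y0 \<ge> 1" using mean_one_max_ge_one[OF b(2)] by blast
    have ale: "a x \<le> 1 + \<theta>" for x
      using mult_left_mono[OF y0 a(1)[of x]] lt[of x y0] by simp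
    have ble: "b y \<le> 1 + \<theta>" for y
      using mult_right_mono[OF x0 b(1)[of y]] lt[of x0 y] by simp
    note A = mean_log_near_one[OF a(2) ale m(1,3,2) \<theta>(1) s2[folded \<theta>(2)]]
    note B = mean_log_near_one[OF b(2) ble m(1,4,2) \<theta>(1) s2[folded \<theta>(2)]]
    let ?u = "\<lambda>z. (a (fst z) * b (snd z)) ^ s"
    have "(\<Sum>z\<in>UNIV. pmf W z * ln (?u z)) = s * (\<Sum>z\<in>UNIV. pmf W z * (ln (a (fst z)) + ln (b (snd z))))"
      using less_imp_neq[OF A(1), symmetric] less_imp_neq[OF B(1), symmetric]
      by (simp add: ln_realpow ln_mult sum_distrib_left mult.left_commute)
    also have "\<dots> = s * ((\<Sum>x\<in>UNIV. pmf (map_pmf fst W) x * ln (a x)) + (\<Sum>y\<in>UNIV. pmf (map_pmf snd W) y * ln (b y)))"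
      by (subst sum_pmf_additive) simp
    \<comment> \<open>Each of the two mean logarithms loses at most
      \<open>2 * (M/s)^2\<close>.\<close>
    also have "\<dots> \<ge> s * (- 4 * (M/s)^2)"
      using A(2) B(2) unfolding \<theta>(2) by (intro mult_left_mono) auto
    finally have "(\<Sum>z\<in>UNIV. pmf W z * ln (?u z)) \<ge> - (\<eta> * ln 2)"
      using s3 by simp
    then have "2 powr - (kl_div W Q + \<eta>) \<le> exp ((\<Sum>z\<in>UNIV. pmf W z * ln (?u z)) - ln 2 * kl_div W Q)"
      by (simp add: powr_def algebra_simps)
    also have "\<dots> \<le> (\<Sum>z\<in>UNIV. pmf Q z * ?u z)"
      using A(1) B(1) by (intro gibbs_inequality Q) simp
    finally show ?thesis .
  qed
  have "2 powr - (kl_div W Q + \<eta>) *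
      ((\<Sum>x\<in>UNIV. pmf (map_pmf fst W) x * a x) * (\<Sum>y\<in>UNIV. pmf (map_pmf snd W) y * b y)) ^ s
    \<le> (\<Sum>z\<in>UNIV. pmf Q z * (a (fst z) * b (snd z)) ^ s)"
    if a: "\<And>x. a x \<ge> 0" and b: "\<And>y. b y \<ge> 0" for a b
  proof -
    define sa where "sa = (\<Sum>x\<in>UNIV. pmf (map_pmf fst W) x * a x)"
    define sb where "sb = (\<Sum>y\<in>UNIV. pmf (map_pmf snd W) y * b y)"
    have nn: "sa \<ge> 0" "sb \<ge> 0" unfolding sa_def sb_def using a b by (auto intro!: sum_nonneg)
    have rhs: "(\<Sum>z\<in>UNIV. pmf Q z * (a (fst z) * b (snd z)) ^ s) \<ge> 0"
      using a b by (auto intro!: sum_nonneg)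
    show ?thesis
    \<comment> \<open>A vanishing mean cannot be divided out, but then the left-hand side is 0
      because \<open>s\<close> is positive.\<close>
    proof (cases "sa = 0 \<or> sb = 0")
      case True
      then have "(sa * sb) ^ s = 0" using s1 by auto
      then show ?thesis using rhs unfolding sa_def[symmetric] sb_def[symmetric] by (simp only: mult_zero_right)
    next
      case False
      then have pos: "sa > 0" "sb > 0" using nn by auto
      have "2 powr - (kl_div W Q + \<eta>) \<le> (\<Sum>z\<in>UNIV. pmf Q z * (a (fst z) / sa * (b (snd z) / sb)) ^ s)"
        using pos a b by (intro normalised) (auto simp: sa_def sb_def simp flip: sum_divide_distrib)
      also have "\<dots> = (\<Sum>z\<in>UNIV. pmf Q z * (a (fst z) * b (snd z)) ^ s) / (sa * sb) ^ s"
        by (simp add: sum_divide_distrib power_mult_distrib power_divide)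
      finally show ?thesis
        using pos unfolding sa_def[symmetric] sb_def[symmetric] by (simp add: pos_le_divide_eq)
    qed
  qed
  then show ?thesis using s1 by (intro exI[of _ s]) auto
qed

text \<open>Induction on the first letter: the probabilities of the sections of \<open>A\<close> and
  \<open>B\<close> serve as \<open>a\<close> and \<open>b\<close> in the one-letter inequality. Its
  right-hand side carries the power \<open>s\<close> inside the sum, exactly where the induction
  hypothesis applies.\<close>

lemma rectangle_lower_bound:
  fixes Q :: "('x :: finite \<times> 'y :: finite) pmf" and PX :: "'x pmf" and PY :: "'y pmf"
  assumes s: "s > (0::nat)" and c: "c \<ge> 0"
    and one: "\<And>a b. (\<And>x. a x \<ge> 0) \<Longrightarrow> (\<And>y. b y \<ge> 0) \<Longrightarrow>
       c * ((\<Sum>x\<in>UNIV. pmf PX x * a x) * (\<Sum>y\<in>UNIV. pmf PY y * b y)) ^ s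
       \<le> (\<Sum>z\<in>UNIV. pmf Q z * (a (fst z) * b (snd z)) ^ s)"
  shows "c ^ n * (measure_pmf.prob (replicate_pmf n PX) A * measure_pmf.prob (replicate_pmf n PY) B) ^ s
    \<le> measure_pmf.prob (replicate_pmf n Q) {zs. map fst zs \<in> A \<and> map snd zs \<in> B}"
proof (induction n arbitrary: A B)
  case 0
  \<comment> \<open>Positivity of \<open>s\<close> gives \<open>0 ^ s = 0\<close> when
    \<open>A\<close> or \<open>B\<close> misses the empty word.\<close>
  then show ?case using s
    by (auto simp: prob_replicate_0 power_0_left simp del: replicate_pmf.simps)
next
  case (Suc n)
  let ?a = "\<lambda>x. measure_pmf.prob (replicate_pmf n PX) {xs. x # xs \<in> A}"
  let ?b = "\<lambda>y. measure_pmf.prob (replicate_pmf n PY) {ys. y # ys \<in> B}"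
  have "c ^ Suc n * (measure_pmf.prob (replicate_pmf (Suc n) PX) A * measure_pmf.prob (replicate_pmf (Suc n) PY) B) ^ s
    = c ^ n * (c * ((\<Sum>x\<in>UNIV. pmf PX x * ?a x) * (\<Sum>y\<in>UNIV. pmf PY y * ?b y)) ^ s)"
    unfolding prob_replicate_Suc by simp
  also have "\<dots> \<le> c ^ n * (\<Sum>z\<in>UNIV. pmf Q z * (?a (fst z) * ?b (snd z)) ^ s)"
    using c by (intro mult_left_mono one) auto
  also have "\<dots> = (\<Sum>z\<in>UNIV. pmf Q z * (c ^ n * (?a (fst z) * ?b (snd z)) ^ s))"
    by (simp add: sum_distrib_left mult.left_commute)
  also have "\<dots> \<le> (\<Sum>z\<in>UNIV. pmf Q z * measure_pmf.prob (replicate_pmf n Q)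
      {zs. map fst zs \<in> {xs. fst z # xs \<in> A} \<and> map snd zs \<in> {ys. snd z # ys \<in> B}})"
    by (intro sum_mono mult_left_mono Suc.IH) auto
  also have "\<dots> = measure_pmf.prob (replicate_pmf (Suc n) Q) {zs. map fst zs \<in> A \<and> map snd zs \<in> B}"
    unfolding prob_replicate_Suc by simp
  finally show ?case .
qed

section \<open>The divergence minimiser\<close>

lemma ex_pmf_of_fun:
  fixes w :: "'a :: finite \<Rightarrow> real"
  assumes nn: "\<And>z. w z \<ge> 0" and one: "(\<Sum>z\<in>UNIV. w z) = 1"
  shows "\<exists>W. pmf W = w"
proof -
  have "pmf (embed_pmf w) = w"
    using assms by (intro ext pmf_embed_pmf) (auto simp: nn_integral_count_space_finite)
  then show ?thesis by blast
qed

lemma pmf_map_fst: "pmf (map_pmf fst W) x = (\<Sum>y\<in>UNIV. pmf W (x, y))"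
  for W :: "('x \<times> 'y :: finite) pmf"
proof -
  have "fst -` {x} = Pair x ` (UNIV :: 'y set)" by auto
  then show ?thesis
    by (simp add: pmf_map measure_measure_pmf_finite sum.reindex inj_on_def)
qed

lemma pmf_map_snd: "pmf (map_pmf snd W) y = (\<Sum>x\<in>UNIV. pmf W (x, y))"
  for W :: "('x :: finite \<times> 'y) pmf"
proof -
  have "snd -` {y} = (\<lambda>x. (x, y)) ` (UNIV :: 'x set)" by auto
  then show ?thesis
    by (simp add: pmf_map measure_measure_pmf_finite sum.reindex inj_on_def)
qed

lemma same_marginals_iff:
  fixes W P :: "('x :: finite \<times> 'y :: finite) pmf"
  shows "W \<in> same_marginals P \<longleftrightarrow>
    (\<forall>x. (\<Sum>y\<in>UNIV. pmf W (x, y)) = (\<Sum>y\<in>UNIV. pmf P (x, y))) \<and>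
    (\<forall>y. (\<Sum>x\<in>UNIV. pmf W (x, y)) = (\<Sum>x\<in>UNIV. pmf P (x, y)))"
  by (simp add: same_marginals_def pmf_eq_iff pmf_map_fst pmf_map_snd)

text \<open>Only the point 0 is delicate: the factor \<open>w\<close> makes the value 0 there, which
  is also the limit of \<open>w * ln w\<close>.\<close>

lemma continuous_on_mult_log:
  fixes q :: real
  assumes "q > 0"
  shows "continuous_on {0..} (\<lambda>w. w * log 2 (w / q))"
proof -
  have "((\<lambda>w. w * ln w) \<longlongrightarrow> 0) (at_right (0::real))"
    by real_asymp
  then have "continuous (at w within {0..}) (\<lambda>w. w * ln w)" if "w \<ge> 0" for w :: real
  proof (cases "w = 0")
    case False
    then have "isCont (\<lambda>w. w * ln w) w" by (intro continuous_intros) auto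
    then show ?thesis by (rule continuous_at_imp_continuous_at_within)
  qed (simp add: continuous_within at_within_Ici_at_right)
  then have "continuous_on {0..} (\<lambda>w::real. w * ln w)"
    by (simp add: continuous_on_eq_continuous_within)
  then have "continuous_on {0..} (\<lambda>w. w * ln w - w * ln q)"
    by (rule continuous_on_diff) (intro continuous_intros)
  then have "continuous_on {0..} (\<lambda>w. (w * ln w - w * ln q) / ln 2)"
    by (rule continuous_on_divide) auto
  moreover have "(w * ln w - w * ln q) / ln 2 = w * log 2 (w / q)" if "w \<in> {0..}" for w
    using that assms by (cases "w = 0") (auto simp: log_def ln_div field_simps)
  ultimately show ?thesis by (rule continuous_on_eq)
qed

text \<open>Laws are encoded as vectors so that Euclidean compactness applies: the constraint set is
  closed, bounded and contains \<open>P\<close>, and the divergence is continuous on it up to the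
  boundary.\<close>

lemma kl_div_minimiser_exists:
  fixes P Q :: "('x :: finite \<times> 'y :: finite) pmf"
  assumes Q: "set_pmf Q = UNIV"
  shows "\<exists>W. is_arg_min (\<lambda>W. kl_div W Q) (\<lambda>W. W \<in> same_marginals P) W"
proof -
  define S :: "(real ^ ('x \<times> 'y)) set" where
    "S = {w. (\<forall>z. 0 \<le> w $ z) \<and> (\<Sum>z\<in>UNIV. w $ z) = 1 \<and>
      (\<forall>x. (\<Sum>y\<in>UNIV. w $ (x, y)) = (\<Sum>y\<in>UNIV. pmf P (x, y))) \<and>
      (\<forall>y. (\<Sum>x\<in>UNIV. w $ (x, y)) = (\<Sum>x\<in>UNIV. pmf P (x, y)))}"
  have "closed S"
    unfolding S_def
    by (intro closed_Collect_conj closed_Collect_all closed_Collect_le closed_Collect_eq continuous_intros)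
  moreover have "w $ z \<le> 1" if "w \<in> S" for w z
    using that member_le_sum[of z UNIV "\<lambda>z. w $ z"] by (auto simp: S_def)
  then have "S \<subseteq> cbox 0 (\<chi> z. 1)"
    by (auto simp: mem_box_cart S_def simp del: split_paired_All)
  then have "bounded S"
    using bounded_cbox bounded_subset by blast
  ultimately have "compact S"
    by (simp add: compact_eq_bounded_closed)
  moreover have vec: "(\<chi> z. pmf W z) \<in> S" if "W \<in> same_marginals P" for W
    using that by (simp add: S_def sum_pmf_UNIV same_marginals_iff)
  have "S \<noteq> {}" using vec[of P] by (auto simp: same_marginals_def)
  moreover have "continuous_on S (\<lambda>w. \<Sum>z\<in>UNIV. w $ z * log 2 (w $ z / pmf Q z))"
  proof (intro continuous_on_sum)
    fix z
    have "continuous_on S ((\<lambda>w. w * log 2 (w / pmf Q z)) \<circ> (\<lambda>w. w $ z))"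
      by (intro continuous_on_compose continuous_on_subset[OF continuous_on_mult_log] continuous_intros)
        (use Q in \<open>auto simp: S_def pmf_positive simp del: split_paired_All\<close>)
    then show "continuous_on S (\<lambda>w. w $ z * log 2 (w $ z / pmf Q z))" by (simp add: comp_def)
  qed
  ultimately have "\<exists>w\<in>S. \<forall>v\<in>S. (\<Sum>z\<in>UNIV. w $ z * log 2 (w $ z / pmf Q z))
      \<le> (\<Sum>z\<in>UNIV. v $ z * log 2 (v $ z / pmf Q z))"
    by (rule continuous_attains_inf)
  then obtain w where w: "w \<in> S"
    and min: "\<And>v. v \<in> S \<Longrightarrow> (\<Sum>z\<in>UNIV. w $ z * log 2 (w $ z / pmf Q z)) \<le> (\<Sum>z\<in>UNIV. v $ z * log 2 (v $ z / pmf Q z))"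
    by blast
  obtain W where W: "pmf W = (\<lambda>z. w $ z)"
    using ex_pmf_of_fun[of "\<lambda>z. w $ z"] w by (auto simp: S_def)
  have "W \<in> same_marginals P"
    using w by (simp add: same_marginals_iff W S_def)
  moreover have "kl_div W Q \<le> kl_div V Q" if "V \<in> same_marginals P" for V
    using min[OF vec[OF that]] by (simp add: kl_div_eq_sum[OF Q] W)
  ultimately show ?thesis
    by (auto simp: is_arg_min_def not_less)
qed

text \<open>The Gibbs inequality for \<open>u = V / Q\<close> bounds the \<open>W\<close>-mean of
  \<open>ln (V / Q)\<close> by the divergence of \<open>W\<close>, hence by that of
  \<open>V\<close>, which is the \<open>V\<close>-mean. The logarithm is taken at \<open>V\<close>
  and not at \<open>W\<close>, so zeros of \<open>W\<close> do no harm and nothing is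
  differentiated.\<close>

lemma minimiser_variational:
  fixes W V Q :: "'a :: finite pmf"
  assumes Q: "set_pmf Q = UNIV" and V: "set_pmf V = UNIV" and le: "kl_div W Q \<le> kl_div V Q"
  shows "0 \<le> (\<Sum>z\<in>UNIV. (pmf V z - pmf W z) * ln (pmf V z / pmf Q z))"
proof -
  have pos: "pmf V z > 0" "pmf Q z > 0" for z using Q V by (auto simp: pmf_positive)
  have "exp ((\<Sum>z\<in>UNIV. pmf W z * ln (pmf V z / pmf Q z)) - ln 2 * kl_div W Q)
      \<le> (\<Sum>z\<in>UNIV. pmf Q z * (pmf V z / pmf Q z))"
    using pos by (intro gibbs_inequality Q) simp
  also have "\<dots> = (\<Sum>z\<in>UNIV. pmf V z)"
    using pos(2) by (intro sum.cong) (auto simp: less_imp_neq[symmetric])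
  finally have "(\<Sum>z\<in>UNIV. pmf W z * ln (pmf V z / pmf Q z)) \<le> ln 2 * kl_div W Q"
    by (simp add: sum_pmf_UNIV)
  also have "\<dots> \<le> ln 2 * kl_div V Q" using le by simp
  also have "\<dots> = (\<Sum>z\<in>UNIV. pmf V z * ln (pmf V z / pmf Q z))"
    by (simp add: kl_div_eq_sum[OF Q] sum_distrib_left log_def)
  finally show ?thesis by (simp add: left_diff_distrib sum_subtractf)
qed

text \<open>
  If \<open>W\<close> vanished at \<open>z0\<close>, the term \<open>P z0 * ln t\<close> would make the variational inequality fail for the
  mixture \<open>(1 - t) W + t P\<close> with small \<open>t\<close>; the constants \<open>C z\<close> bound everything else.
\<close>

lemma minimiser_full_support:
  fixes P Q W :: "('x :: finite \<times> 'y :: finite) pmf"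
  assumes P: "set_pmf P = UNIV" and Q: "set_pmf Q = UNIV"
    and W: "W \<in> same_marginals P" and min: "\<And>V. V \<in> same_marginals P \<Longrightarrow> kl_div W Q \<le> kl_div V Q"
  shows "pmf W z0 > 0"
proof (rule ccontr)
  assume "\<not> ?thesis"
  then have z0: "pmf W z0 = 0" using pmf_nonneg[of W z0] by linarith
  have pos: "pmf P z > 0" "pmf Q z > 0" for z using P Q by (auto simp: pmf_positive)
  define C where "C z = (if pmf W z = 0 then pmf P z * ln (pmf P z / pmf Q z)
      else pmf P z * ln (1 / pmf Q z) - pmf W z * ln (pmf W z / 2 / pmf Q z))" for z
  have bound: "0 \<le> pmf P z0 * ln t + (\<Sum>z\<in>UNIV. C z)" if t: "0 < t" "t \<le> 1/2" for t
  proof -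
    define v where "v z = (1 - t) * pmf W z + t * pmf P z" for z
    have v: "v z > 0" for z
      unfolding v_def using t pos(1)[of z] by (intro add_nonneg_pos) auto
    have "(\<Sum>z\<in>UNIV. v z) = 1"
      by (simp add: v_def sum.distrib sum_pmf_UNIV flip: sum_distrib_left)
    then obtain V where V: "pmf V = v"
      using ex_pmf_of_fun[of v] v by (auto intro: less_imp_le)
    have "V \<in> same_marginals P"
      using W by (simp add: same_marginals_iff V v_def sum.distrib algebra_simps sum_subtractf flip: sum_distrib_left)
    moreover have "set_pmf V = UNIV"
      using v by (auto simp: set_pmf_eq V less_imp_neq[symmetric])
    ultimately have "0 \<le> (\<Sum>z\<in>UNIV. (v z - pmf W z) * ln (v z / pmf Q z))"
      using minimiser_variational[OF Q, of V W] min by (simp add: V)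
    also have "\<dots> = t * (\<Sum>z\<in>UNIV. (pmf P z - pmf W z) * ln (v z / pmf Q z))"
      by (simp add: v_def sum_distrib_left algebra_simps)
    finally have "0 \<le> (\<Sum>z\<in>UNIV. (pmf P z - pmf W z) * ln (v z / pmf Q z))"
      using t by (simp add: zero_le_mult_iff)
    also have "\<dots> \<le> (\<Sum>z\<in>UNIV. C z + (if z = z0 then pmf P z0 * ln t else 0))"
    proof (rule sum_mono)
      fix z
      show "(pmf P z - pmf W z) * ln (v z / pmf Q z) \<le> C z + (if z = z0 then pmf P z0 * ln t else 0)"
      proof (cases "pmf W z = 0")
        \<comment> \<open>Here \<open>v z = t * pmf P z\<close>, so \<open>ln t\<close> splits off
          exactly; away from \<open>z0\<close> this nonpositive term is dropped.\<close>
        case True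
        then have "(pmf P z - pmf W z) * ln (v z / pmf Q z) = C z + pmf P z * ln t"
          using pos[of z] t by (simp add: C_def v_def ln_mult ln_div algebra_simps)
        moreover have "pmf P z * ln t \<le> 0" using t by (simp add: mult_le_0_iff)
        ultimately show ?thesis by auto
      next
        case False
        then have w: "pmf W z > 0" by (simp add: pmf_pos)
        \<comment> \<open>As \<open>t \<le> 1/2\<close>, the value \<open>v z\<close> lies between
          \<open>pmf W z / 2\<close> and 1, which bounds the two logarithmic terms independently of
          \<open>t\<close>.\<close>
        have "pmf V z \<le> 1" by (rule pmf_le_1)
        then have "ln (v z / pmf Q z) \<le> ln (1 / pmf Q z)"
          using pos(2)[of z] v[of z] by (simp add: V divide_le_cancel)
        then have "pmf P z * ln (v z / pmf Q z) \<le> pmf P z * ln (1 / pmf Q z)"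
          by (intro mult_left_mono) auto
        moreover have "pmf W z / 2 \<le> (1 - t) * pmf W z"
          using t mult_right_mono[of "1/2" "1 - t" "pmf W z"] by simp
        then have "pmf W z / 2 \<le> v z"
          unfolding v_def using t pos(1)[of z] by (smt (verit) mult_nonneg_nonneg)
        then have "pmf W z / 2 / pmf Q z \<le> v z / pmf Q z"
          by (rule divide_right_mono) simp
        then have "ln (pmf W z / 2 / pmf Q z) \<le> ln (v z / pmf Q z)"
          using pos(2)[of z] v[of z] w by (subst ln_le_cancel_iff) auto
        then have "pmf W z * ln (pmf W z / 2 / pmf Q z) \<le> pmf W z * ln (v z / pmf Q z)"
          by (intro mult_left_mono) auto
        ultimately have "(pmf P z - pmf W z) * ln (v z / pmf Q z) \<le> C z"
          unfolding C_def left_diff_distrib if_not_P[OF False] by linarith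
        then show ?thesis
          using False z0 by auto
      qed
    qed
    finally show ?thesis by (simp add: sum.distrib add.commute)
  qed
  \<comment> \<open>With this \<open>t\<close> the bound becomes at most
    \<open>- M + (\<Sum>z\<in>UNIV. C z)\<close>, which is at most -1.\<close>
  define M where "M = \<bar>\<Sum>z\<in>UNIV. C z\<bar> + 1"
  define t where "t = min (1/2) (exp (- (M / pmf P z0)))"
  have "ln t \<le> - (M / pmf P z0)"
    unfolding t_def by (subst ln_le_cancel_iff[of _ "exp (- (M / pmf P z0))", simplified]) auto
  then have "pmf P z0 * ln t \<le> - M"
    using pos(1)[of z0] by (simp add: field_simps)
  moreover have "0 \<le> pmf P z0 * ln t + (\<Sum>z\<in>UNIV. C z)"
    by (rule bound) (auto simp: t_def)
  ultimately show False by (simp add: M_def)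
qed

text \<open>A direction with zero row and column sums preserves the marginals, so
  \<open>W + t d\<close> is admissible for small \<open>t\<close> of either sign. The variational
  inequality then reads \<open>0 \<le> t * F t\<close>; letting \<open>t\<close> tend to 0 from the
  right and from the left forces the limit of \<open>F\<close> to be 0.\<close>

lemma minimiser_stationary:
  fixes P Q W :: "('x :: finite \<times> 'y :: finite) pmf" and d :: "'x \<times> 'y \<Rightarrow> real"
  assumes Q: "set_pmf Q = UNIV" and W_pos: "\<And>z. pmf W z > 0"
    and W: "W \<in> same_marginals P" and min: "\<And>V. V \<in> same_marginals P \<Longrightarrow> kl_div W Q \<le> kl_div V Q"
    and d1: "\<And>x. (\<Sum>y\<in>UNIV. d (x, y)) = 0" and d2: "\<And>y. (\<Sum>x\<in>UNIV. d (x, y)) = 0"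
  shows "(\<Sum>z\<in>UNIV. d z * ln (pmf W z / pmf Q z)) = 0"
proof -
  define F where "F t = (\<Sum>z\<in>UNIV. d z * ln ((pmf W z + t * d z) / pmf Q z))" for t
  have Q_pos: "pmf Q z > 0" for z using Q by (auto simp: pmf_positive)
  have "(F \<longlongrightarrow> (\<Sum>z\<in>UNIV. d z * ln ((pmf W z + 0 * d z) / pmf Q z))) (at 0)"
    unfolding F_def using W_pos Q_pos
    by (intro tendsto_intros) (auto simp: less_imp_neq[symmetric])
  then have lim: "(F \<longlongrightarrow> (\<Sum>z\<in>UNIV. d z * ln (pmf W z / pmf Q z))) (at 0)" by simp
  have "\<forall>\<^sub>F t in at 0. \<forall>z. 0 < pmf W z + t * d z"
  proof (rule eventually_all_finite)
    fix z
    have "((\<lambda>t. pmf W z + t * d z) \<longlongrightarrow> pmf W z + 0 * d z) (at 0)"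
      by (intro tendsto_intros)
    then show "\<forall>\<^sub>F t in at 0. 0 < pmf W z + t * d z"
      by (rule order_tendstoD) (simp add: W_pos)
  qed
  then have ev: "\<forall>\<^sub>F t in at 0. 0 \<le> t * F t"
  proof eventually_elim
    case (elim t)
    have "(\<Sum>z\<in>UNIV. d z) = (\<Sum>x\<in>UNIV. \<Sum>y\<in>UNIV. d (x, y))"
      by (simp add: sum.cartesian_product)
    then have "(\<Sum>z\<in>UNIV. pmf W z + t * d z) = 1"
      by (simp add: sum.distrib sum_pmf_UNIV d1 flip: sum_distrib_left)
    then obtain V where V: "pmf V = (\<lambda>z. pmf W z + t * d z)"
      using ex_pmf_of_fun[of "\<lambda>z. pmf W z + t * d z"] elim by (auto intro: less_imp_le)
    have "V \<in> same_marginals P"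
      using W by (simp add: same_marginals_iff V sum.distrib d1 d2 flip: sum_distrib_left)
    moreover have "set_pmf V = UNIV"
      using elim by (auto simp: set_pmf_eq V less_imp_neq[symmetric])
    ultimately have "0 \<le> (\<Sum>z\<in>UNIV. (pmf V z - pmf W z) * ln (pmf V z / pmf Q z))"
      using minimiser_variational[OF Q, of V W] min by simp
    then show ?case by (simp add: V F_def sum_distrib_left mult.assoc)
  qed
  have "\<forall>\<^sub>F t in at_right 0. 0 \<le> F t"
    using filter_leD[OF at_le[OF subset_UNIV] ev] eventually_at_right_less[of 0]
    by eventually_elim (auto simp: zero_le_mult_iff)
  then have "0 \<le> (\<Sum>z\<in>UNIV. d z * ln (pmf W z / pmf Q z))"
    by (intro tendsto_lowerbound[OF tendsto_mono[OF at_le lim]]) auto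
  moreover have "\<forall>\<^sub>F t in at_left (0::real). t < 0"
    by (simp add: eventually_at_filter)
  then have "\<forall>\<^sub>F t in at_left 0. F t \<le> 0"
    using filter_leD[OF at_le[OF subset_UNIV] ev]
    by eventually_elim (auto simp: zero_le_mult_iff)
  then have "(\<Sum>z\<in>UNIV. d z * ln (pmf W z / pmf Q z)) \<le> 0"
    by (intro tendsto_upperbound[OF tendsto_mono[OF at_le lim]]) auto
  ultimately show ?thesis by simp
qed

text \<open>Stationarity makes all mixed second differences of \<open>ln (W / Q)\<close> vanish, and
  such a function on a grid is a row function plus a column function.\<close>

lemma minimiser_factorisation:
  fixes P Q W :: "('x :: finite \<times> 'y :: finite) pmf"
  assumes P: "set_pmf P = UNIV" and Q: "set_pmf Q = UNIV"
    and W: "W \<in> same_marginals P" and min: "\<And>V. V \<in> same_marginals P \<Longrightarrow> kl_div W Q \<le> kl_div V Q"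
  obtains \<phi> :: "'x \<Rightarrow> real" and \<psi> :: "'y \<Rightarrow> real"
  where "\<And>z. pmf W z = pmf Q z * 2 powr (\<phi> (fst z) + \<psi> (snd z))"
proof
  define h where "h z = ln (pmf W z / pmf Q z)" for z
  have W_pos: "pmf W z > 0" for z by (rule minimiser_full_support[OF P Q W min])
  have Q_pos: "pmf Q z > 0" for z using Q by (auto simp: pmf_positive)
  define x0 :: 'x where "x0 = undefined"
  define y0 :: 'y where "y0 = undefined"
  have h: "h (x, y) = h (x, y0) + (h (x0, y) - h (x0, y0))" for x y
  proof -
    \<comment> \<open>The signed 4-cycle through the arbitrary base point \<open>(x0, y0)\<close>:
      +1 at \<open>(x, y)\<close> and \<open>(x0, y0)\<close>, -1 at the other two corners, and
      identically 0 if \<open>x = x0\<close> or \<open>y = y0\<close>.\<close>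
    define d :: "'x \<times> 'y \<Rightarrow> real" where
      "d z = (of_bool (fst z = x) - of_bool (fst z = x0)) * (of_bool (snd z = y) - of_bool (snd z = y0))" for z
    have "(\<Sum>z\<in>UNIV. d z * h z) = 0"
      unfolding h_def
      by (rule minimiser_stationary[OF Q W_pos W min])
        (simp_all add: d_def sum_subtractf flip: sum_distrib_left sum_distrib_right)
    also have "(\<Sum>z\<in>UNIV. d z * h z) = (\<Sum>a\<in>UNIV. \<Sum>b\<in>UNIV. d (a, b) * h (a, b))"
      by (simp add: sum.cartesian_product)
    also have "\<dots> = (\<Sum>a\<in>UNIV. (of_bool (a = x) - of_bool (a = x0)) *
        (\<Sum>b\<in>UNIV. (of_bool (b = y) - of_bool (b = y0)) * h (a, b)))"
      by (simp add: d_def sum_distrib_left mult.assoc)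
    also have "\<dots> = h (x, y) - h (x, y0) - (h (x0, y) - h (x0, y0))"
      by (simp add: left_diff_distrib sum_subtractf of_bool_def if_distrib[of "\<lambda>a. a * _"] cong: if_cong)
    finally show ?thesis by simp
  qed
  let ?\<phi> = "\<lambda>x. h (x, y0) / ln 2" and ?\<psi> = "\<lambda>y. (h (x0, y) - h (x0, y0)) / ln 2"
  show "pmf W z = pmf Q z * 2 powr (?\<phi> (fst z) + ?\<psi> (snd z))" for z
  proof -
    have "?\<phi> (fst z) + ?\<psi> (snd z) = h z / ln 2"
      using h[of "fst z" "snd z"] by (simp add: add_divide_distrib)
    also have "2 powr (h z / ln 2) = pmf W z / pmf Q z"
      using W_pos[of z] Q_pos[of z] by (simp add: powr_def h_def)
    ultimately show ?thesis using Q_pos[of z] by simp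
  qed
qed

section \<open>Converse\<close>

lemma message_tuples_snoc:
  "ms \<in> message_tuples s k \<Longrightarrow> m \<in> {1..s (Suc k)} \<Longrightarrow> ms @ [m] \<in> message_tuples s (Suc k)"
  by (auto simp: message_tuples_def nth_append less_Suc_eq)

lemma card_message_tuples: "finite (message_tuples s m) \<and> card (message_tuples s m) \<le> (\<Prod>k=1..m. s k)"
proof (induction m)
  case 0
  have "message_tuples s 0 = {[]}" by (auto simp: message_tuples_def)
  then show ?case by simp
next
  case (Suc m)
  have sub: "message_tuples s (Suc m) \<subseteq> (\<lambda>(ms, a). ms @ [a]) ` (message_tuples s m \<times> {1..s (Suc m)})"
  proof
    fix ms assume ms: "ms \<in> message_tuples s (Suc m)"
    then have "ms = butlast ms @ [last ms]"
      by (intro append_butlast_last_id[symmetric]) (auto simp: message_tuples_def)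
    moreover have "butlast ms \<in> message_tuples s m"
      using ms by (auto simp: message_tuples_def nth_butlast)
    moreover have "last ms = ms ! m"
      using ms by (subst last_conv_nth) (auto simp: message_tuples_def)
    then have "last ms \<in> {1..s (Suc m)}"
      using ms by (simp add: message_tuples_def)
    ultimately show "ms \<in> (\<lambda>(ms, a). ms @ [a]) ` (message_tuples s m \<times> {1..s (Suc m)})"
      by (intro image_eqI[of _ _ "(butlast ms, last ms)"]) auto
  qed
  have fin: "finite (message_tuples s m \<times> {1..s (Suc m)})" using Suc by simp
  have "card (message_tuples s (Suc m)) \<le> card (message_tuples s m \<times> {1..s (Suc m)})"
    using card_mono[OF finite_imageI[OF fin] sub] card_image_le[OF fin] order_trans by blast
  also have "\<dots> \<le> (\<Prod>k=1..m. s k) * s (Suc m)"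
    using Suc by (simp add: card_cartesian_product)
  finally show ?case
    using finite_subset[OF sub finite_imageI[OF fin]] by simp
qed

lemma transcript_in_message_tuples:
  assumes C: "is_code K n C" and n: "length xs = n" "length ys = n" and "k \<le> K"
  shows "fst (transcript C xs ys k) \<in> message_tuples (fsize C) k
    \<and> snd (transcript C xs ys k) \<in> message_tuples (gsize C) k"
  using \<open>k \<le> K\<close>
proof (induction k)
  case 0
  then show ?case by (simp add: message_tuples_def)
next
  case (Suc k)
  then have IH: "fst (transcript C xs ys k) \<in> message_tuples (fsize C) k"
    "snd (transcript C xs ys k) \<in> message_tuples (gsize C) k" by auto
  have k: "Suc k \<in> {1..K}" using Suc.prems by simp
  let ?fs = "fst (transcript C xs ys k) @ [fenc C (Suc k) (xs, snd (transcript C xs ys k))]"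
  have "fenc C (Suc k) \<in> words n \<times> message_tuples (gsize C) k \<rightarrow> {1..fsize C (Suc k)}"
    using C k unfolding is_code_def by force
  then have fs: "?fs \<in> message_tuples (fsize C) (Suc k)"
    using IH n by (intro message_tuples_snoc) (auto simp: words_def)
  have "genc C (Suc k) \<in> words n \<times> message_tuples (fsize C) (Suc k) \<rightarrow> {1..gsize C (Suc k)}"
    using C k unfolding is_code_def by force
  then have "snd (transcript C xs ys k) @ [genc C (Suc k) (ys, ?fs)] \<in> message_tuples (gsize C) (Suc k)"
    using IH n fs by (intro message_tuples_snoc) (auto simp: words_def)
  then show ?case using fs by (simp add: case_prod_unfold Let_def)
qed

text \<open>The cut-and-paste property of two-party protocols. Once the histories agree, the next
  message of node A depends on \<open>xs\<close> alone and that of node B on \<open>ys'\<close>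
  alone, so the mixed pair copies the first from one run and the second from the other.\<close>

lemma transcript_rectangle:
  assumes "transcript C xs ys k = t" and "transcript C xs' ys' k = t"
  shows "transcript C xs ys' k = t"
  using assms
proof (induction k arbitrary: t)
  case 0
  then show ?case by simp
next
  case (Suc k)
  have "transcript C xs ys (Suc k) = transcript C xs' ys' (Suc k)"
    using Suc.prems by simp
  then have eq: "transcript C xs ys k = transcript C xs' ys' k"
    by (simp add: case_prod_unfold Let_def prod_eq_iff)
  then have "transcript C xs ys' k = transcript C xs ys k"
    using Suc.IH[OF refl] by simp
  with eq Suc.prems show ?case
    by (auto simp: case_prod_unfold Let_def)
qed

lemma pigeonhole_sum:
  fixes f :: "'a \<Rightarrow> real"
  assumes "finite T" and m: "0 < m" "m \<le> sum f T"
  shows "\<exists>t\<in>T. m / card T \<le> f t"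
proof (rule ccontr)
  assume "\<not> ?thesis"
  then have "f t < m / card T" if "t \<in> T" for t using that by (auto simp: not_le)
  moreover have "T \<noteq> {}" using m by auto
  ultimately have "sum f T < of_nat (card T) * (m / card T)"
    using \<open>finite T\<close> by (intro sum_bounded_above_strict) (auto simp: card_gt_0_iff)
  then show False using m \<open>T \<noteq> {}\<close> \<open>finite T\<close> by simp
qed

text \<open>The accepted words split by transcript into at most as many classes as there are message
  tuples; by the union bound one class has at least the average share of
  \<open>1 - \<epsilon>\<close>.\<close>

lemma exists_accepting_rectangle:
  fixes P :: "('x :: finite \<times> 'y :: finite) pmf"
  assumes C: "is_code K n C" and err: "type1_error K P n C \<le> \<epsilon>" and \<epsilon>: "\<epsilon> < 1"
  shows "\<exists>A B. (1 - \<epsilon>) / ((\<Prod>k=1..K. real (fsize C k)) * (\<Prod>k=1..K. real (gsize C k)))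
        \<le> measure_pmf.prob (replicate_pmf n P) {zs. map fst zs \<in> A \<and> map snd zs \<in> B}
    \<and> {zs. map fst zs \<in> A \<and> map snd zs \<in> B} \<subseteq> {zs. decision K C zs = 0}"
proof -
  let ?M = "replicate_pmf n P"
  let ?tr = "\<lambda>zs. transcript C (map fst zs) (map snd zs) K"
  define T where "T = message_tuples (fsize C) K \<times> message_tuples (gsize C) K"
  define R where "R t = {zs. length zs = n \<and> ?tr zs = t \<and> decide C (map fst zs, snd t) = 0}" for t
  define N where "N = (\<Prod>k=1..K. real (fsize C k)) * (\<Prod>k=1..K. real (gsize C k))"
  have T: "finite T" "real (card T) \<le> N"
  proof -
    show "finite T" unfolding T_def using card_message_tuples by blast
    have "card T \<le> (\<Prod>k=1..K. fsize C k) * (\<Prod>k=1..K. gsize C k)"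
      unfolding T_def card_cartesian_product using card_message_tuples by (intro mult_mono) blast+
    then have "real (card T) \<le> real ((\<Prod>k=1..K. fsize C k) * (\<Prod>k=1..K. gsize C k))"
      by (rule of_nat_mono)
    then show "real (card T) \<le> N" by (simp add: N_def)
  qed
  have tr: "?tr zs \<in> T" if "length zs = n" for zs
    using transcript_in_message_tuples[OF C, of "map fst zs" "map snd zs" K] that
    by (simp add: T_def mem_Times_iff)
  have len: "length zs = n" if "zs \<in> set_pmf ?M" for zs
    using that by (simp add: set_replicate_pmf)
  have dec: "decision K C zs \<in> {0, 1}" if "length zs = n" for zs
  proof -
    have "decide C \<in> words n \<times> message_tuples (gsize C) K \<rightarrow> {0, 1}"
      using C by (simp add: is_code_def)
    moreover have "(map fst zs, snd (?tr zs)) \<in> words n \<times> message_tuples (gsize C) K"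
      using tr[OF that] that by (simp add: words_def T_def mem_Times_iff)
    ultimately show ?thesis
      unfolding decision_def Let_def by (rule funcset_mem)
  qed
  \<comment> \<open>The cover is needed only on the support: the code conditions constrain words of
    length \<open>n\<close> alone.\<close>
  have "1 = measure_pmf.prob ?M (set_pmf ?M)"
    using measure_Int_set_pmf[of ?M UNIV] by simp
  also have "\<dots> \<le> measure_pmf.prob ?M ({zs. decision K C zs = 1} \<union> (\<Union>t\<in>T. R t))"
  proof (rule measure_pmf.finite_measure_mono)
    show "set_pmf ?M \<subseteq> {zs. decision K C zs = 1} \<union> (\<Union>t\<in>T. R t)"
    proof
      fix zs assume "zs \<in> set_pmf ?M"
      then have zs: "length zs = n" by (rule len)
      have "zs \<in> R (?tr zs)" if "decision K C zs = 0"
        using that zs by (simp add: R_def decision_def Let_def)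
      then show "zs \<in> {zs. decision K C zs = 1} \<union> (\<Union>t\<in>T. R t)"
        using dec[OF zs] tr[OF zs] by auto
    qed
  qed simp
  also have "\<dots> \<le> measure_pmf.prob ?M {zs. decision K C zs = 1} + measure_pmf.prob ?M (\<Union>t\<in>T. R t)"
    by (rule measure_Un_le) auto
  also have "measure_pmf.prob ?M (\<Union>t\<in>T. R t) \<le> (\<Sum>t\<in>T. measure_pmf.prob ?M (R t))"
    using T by (intro measure_pmf.finite_measure_subadditive_finite) auto
  finally have "1 - \<epsilon> \<le> (\<Sum>t\<in>T. measure_pmf.prob ?M (R t))"
    using err by (simp add: type1_error_def)
  then obtain t where t: "t \<in> T" "(1 - \<epsilon>) / card T \<le> measure_pmf.prob ?M (R t)"
    using pigeonhole_sum[OF T(1), of "1 - \<epsilon>" "\<lambda>t. measure_pmf.prob ?M (R t)"] \<epsilon> by auto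
  \<comment> \<open>These sets contain the projections of \<open>R t\<close>. The decision is a
    function of node A's word and of \<open>t\<close>, so it can be absorbed into \<open>A\<close>;
    the transcript stays \<open>t\<close> on the whole rectangle.\<close>
  define A where "A = {xs. decide C (xs, snd t) = 0 \<and> (\<exists>ys. transcript C xs ys K = t)}"
  define B where "B = {ys. \<exists>xs. transcript C xs ys K = t}"
  have "0 < card T" using t(1) T(1) by (auto simp: card_gt_0_iff)
  then have "(1 - \<epsilon>) / N \<le> (1 - \<epsilon>) / card T"
    using T(2) \<epsilon> by (intro divide_left_mono mult_pos_pos) auto
  also note t(2)
  also have "measure_pmf.prob ?M (R t) \<le> measure_pmf.prob ?M {zs. map fst zs \<in> A \<and> map snd zs \<in> B}"
    by (intro measure_pmf.finite_measure_mono) (auto simp: R_def A_def B_def)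
  finally have "(1 - \<epsilon>) / N \<le> measure_pmf.prob ?M {zs. map fst zs \<in> A \<and> map snd zs \<in> B}" .
  moreover have "{zs. map fst zs \<in> A \<and> map snd zs \<in> B} \<subseteq> {zs. decision K C zs = 0}"
  proof safe
    fix zs assume "map fst zs \<in> A" "map snd zs \<in> B"
    then obtain xs ys where "decide C (map fst zs, snd t) = 0"
      and "transcript C (map fst zs) ys K = t" "transcript C xs (map snd zs) K = t"
      by (auto simp: A_def B_def)
    then show "decision K C zs = 0"
      using transcript_rectangle[of C "map fst zs" ys K t xs "map snd zs"]
      by (simp add: decision_def Let_def)
  qed
  ultimately show ?thesis unfolding N_def by blast
qed

section \<open>From rectangles to the exponent\<close>

lemma prob_rectangle_le_marginals:
  fixes P :: "('x \<times> 'y) pmf"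
  shows "measure_pmf.prob (replicate_pmf n P) {zs. map fst zs \<in> A \<and> map snd zs \<in> B}
      \<le> measure_pmf.prob (replicate_pmf n (map_pmf fst P)) A"
    and "measure_pmf.prob (replicate_pmf n P) {zs. map fst zs \<in> A \<and> map snd zs \<in> B}
      \<le> measure_pmf.prob (replicate_pmf n (map_pmf snd P)) B"
  by (auto simp: replicate_pmf_map intro!: measure_pmf.finite_measure_mono)

lemma code_sizes_pos:
  assumes "is_code K n C" "k \<in> {1..K}"
  shows "fsize C k > 0" "gsize C k > 0"
proof -
  have "1 \<le> fsize C k \<and> 1 \<le> gsize C k"
    using assms unfolding is_code_def by blast
  then show "fsize C k > 0" "gsize C k > 0" by auto
qed

lemma log_prod:
  fixes f :: "'a \<Rightarrow> real"
  assumes "finite I" and "\<And>i. i \<in> I \<Longrightarrow> f i > 0"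
  shows "log b (prod f I) = (\<Sum>i\<in>I. log b (f i))"
proof -
  have "ln (prod f I) = (\<Sum>i\<in>I. ln (f i))"
    using assms by (intro ln_prod) (auto simp: less_imp_neq[symmetric])
  then show ?thesis by (simp add: log_def sum_divide_distrib)
qed

text \<open>A rectangle is at most as probable as each of its sides, and the sides see only
  marginals, which \<open>W\<close> shares with \<open>P\<close>. The power \<open>s\<close> is
  fixed by the slack \<open>\<eta>\<close> before \<open>n\<close> grows, so the factor coming from
  the number of transcripts stays subexponential.\<close>

lemma converse:
  fixes P Q W :: "('x :: finite \<times> 'y :: finite) pmf"
  assumes P: "set_pmf P = UNIV" and Q: "set_pmf Q = UNIV" and \<epsilon>: "\<epsilon> < 1"
    and W: "W \<in> same_marginals P" and C: "zero_rate_codes K C"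
    and err: "\<forall>\<^sub>F n in sequentially. type1_error K P n (C n) \<le> \<epsilon>"
  shows "limsup (\<lambda>n. error_exponent n (type2_error K Q n (C n))) \<le> ereal (kl_div W Q)"
proof (rule ereal_le_epsilon2)
  fix \<eta> :: real assume \<eta>: "0 < \<eta>"
  let ?PX = "map_pmf fst P" and ?PY = "map_pmf snd P"
  have marg: "map_pmf fst W = ?PX" "map_pmf snd W = ?PY"
    using W by (auto simp: same_marginals_def)
  have full: "set_pmf (map_pmf fst W) = UNIV" "set_pmf (map_pmf snd W) = UNIV"
    unfolding marg using P by simp_all
  define c where "c = 2 powr - (kl_div W Q + \<eta>)"
  obtain s :: nat where s: "s > 0"
    and one: "\<And>a b. (\<And>x. a x \<ge> 0) \<Longrightarrow> (\<And>y. b y \<ge> 0) \<Longrightarrow>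
      c * ((\<Sum>x\<in>UNIV. pmf ?PX x * a x) * (\<Sum>y\<in>UNIV. pmf ?PY y * b y)) ^ s
      \<le> (\<Sum>z\<in>UNIV. pmf Q z * (a (fst z) * b (snd z)) ^ s)"
    using reverse_hoelder[OF Q full \<eta>] unfolding marg c_def by blast
  define L where "L n = (\<Sum>k=1..K. log 2 (real (fsize (C n) k))) + (\<Sum>k=1..K. log 2 (real (gsize (C n) k)))" for n
  have code: "is_code K n (C n)" for n using C by (simp add: zero_rate_codes_def)
  have "L \<in> o(\<lambda>n. real n)"
    using C unfolding zero_rate_codes_def L_def by simp
  then have L: "(\<lambda>n. L n / real n) \<longlonglongrightarrow> 0" by (rule smalloD_tendsto)
  \<comment> \<open>This is \<open>- 1 / n\<close> times the logarithm of the lower bound on the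
    second error; the factor 2 counts the two sides of the rectangle.\<close>
  define b where "b n = kl_div W Q + \<eta> + 2 * real s * (L n / real n - log 2 (1 - \<epsilon>) / real n)" for n
  have "(\<lambda>n. log 2 (1 - \<epsilon>) / real n) \<longlonglongrightarrow> 0"
    by (rule lim_const_over_n)
  then have "b \<longlonglongrightarrow> kl_div W Q + \<eta> + 2 * real s * (0 - 0)"
    unfolding b_def by (intro tendsto_intros L)
  then have b: "(\<lambda>n. ereal (b n)) \<longlonglongrightarrow> ereal (kl_div W Q + \<eta>)" by simp
  have "\<forall>\<^sub>F n in sequentially. error_exponent n (type2_error K Q n (C n)) \<le> ereal (b n)"
    using err eventually_gt_at_top[of 0]
  proof eventually_elim
    case (elim n)
    define N where "N = (\<Prod>k=1..K. real (fsize (C n) k)) * (\<Prod>k=1..K. real (gsize (C n) k))"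
    have pos: "fsize (C n) k > 0" "gsize (C n) k > 0" if "k \<in> {1..K}" for k
      using code_sizes_pos[OF code that] by auto
    have prods: "0 < (\<Prod>k=1..K. real (fsize (C n) k))" "0 < (\<Prod>k=1..K. real (gsize (C n) k))"
      using pos by (auto intro!: prod_pos)
    then have N: "N > 0" unfolding N_def by (rule mult_pos_pos)
    have "log 2 N = L n"
      using prods pos log_prod[of "{1..K}" "\<lambda>k. real (fsize (C n) k)" 2]
        log_prod[of "{1..K}" "\<lambda>k. real (gsize (C n) k)" 2]
      by (simp add: N_def L_def log_mult)
    obtain A B where AB: "(1 - \<epsilon>) / N \<le> measure_pmf.prob (replicate_pmf n P) {zs. map fst zs \<in> A \<and> map snd zs \<in> B}"
      and sub: "{zs. map fst zs \<in> A \<and> map snd zs \<in> B} \<subseteq> {zs. decision K (C n) zs = 0}"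
      using exists_accepting_rectangle[OF code elim(1) \<epsilon>] unfolding N_def by blast
    have "c ^ n * ((1 - \<epsilon>) / N * ((1 - \<epsilon>) / N)) ^ s
      \<le> c ^ n * (measure_pmf.prob (replicate_pmf n ?PX) A * measure_pmf.prob (replicate_pmf n ?PY) B) ^ s"
      using order_trans[OF AB prob_rectangle_le_marginals(1)] order_trans[OF AB prob_rectangle_le_marginals(2)] \<epsilon> N
      by (intro mult_left_mono power_mono mult_mono) (auto simp: c_def)
    also have "\<dots> \<le> measure_pmf.prob (replicate_pmf n Q) {zs. map fst zs \<in> A \<and> map snd zs \<in> B}"
      by (intro rectangle_lower_bound s one) (auto simp: c_def)
    also have "\<dots> \<le> type2_error K Q n (C n)"
      unfolding type2_error_def by (intro measure_pmf.finite_measure_mono sub) auto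
    finally have le: "c ^ n * ((1 - \<epsilon>) / N * ((1 - \<epsilon>) / N)) ^ s \<le> type2_error K Q n (C n)" .
    \<comment> \<open>Positivity permits taking logarithms and excludes the value
      \<open>\<infinity>\<close> of the exponent.\<close>
    have pos': "0 < c ^ n * ((1 - \<epsilon>) / N * ((1 - \<epsilon>) / N)) ^ s"
      using N \<epsilon> by (intro mult_pos_pos zero_less_power) (auto simp: c_def)
    have "log 2 (c ^ n * ((1 - \<epsilon>) / N * ((1 - \<epsilon>) / N)) ^ s)
      = real n * log 2 c + real s * (2 * (log 2 (1 - \<epsilon>) - log 2 N))"
      using N \<epsilon> by (simp add: log_mult log_nat_power log_divide c_def)
    also have "\<dots> = - real n * b n"
      using elim(2) \<open>log 2 N = L n\<close> by (simp add: b_def c_def field_simps)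
    finally have "- real n * b n \<le> log 2 (type2_error K Q n (C n))"
      using le pos' by (subst (asm) eq_commute) simp
    then have "- (1 / real n) * log 2 (type2_error K Q n (C n)) \<le> b n"
      using elim(2) by (simp add: field_simps)
    then show ?case using le pos' by (simp add: error_exponent_def)
  qed
  then have "limsup (\<lambda>n. error_exponent n (type2_error K Q n (C n))) \<le> limsup (\<lambda>n. ereal (b n))"
    by (rule Limsup_mono)
  also have "\<dots> = ereal (kl_div W Q + \<eta>)"
    using b by (intro lim_imp_Limsup) auto
  finally show "limsup (\<lambda>n. error_exponent n (type2_error K Q n (C n))) \<le> ereal (kl_div W Q) + ereal \<eta>"
    by simp
qed

section \<open>Achievability\<close>

text \<open>The offset \<open>c\<close> collects the letters already read. Centring removes the
  cross term of \<open>(c + g z)^2\<close>, so each letter adds one variance.\<close>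

lemma chebyshev_words:
  fixes P :: "'a :: finite pmf" and g :: "'a \<Rightarrow> real"
  assumes g: "(\<Sum>z\<in>UNIV. pmf P z * g z) = 0" and t: "t > 0"
  shows "measure_pmf.prob (replicate_pmf n P) {zs. t \<le> \<bar>c + sum_list (map g zs)\<bar>}
    \<le> (c^2 + n * (\<Sum>z\<in>UNIV. pmf P z * (g z)^2)) / t^2"
proof (induction n arbitrary: c)
  case 0
  have "t^2 \<le> c^2" if "t \<le> \<bar>c\<bar>"
    using that t by (simp flip: abs_le_square_iff)
  then show ?case
    using t by (auto simp: prob_replicate_0 le_divide_eq simp del: replicate_pmf.simps)
next
  case (Suc n)
  let ?v = "\<Sum>z\<in>UNIV. pmf P z * (g z)^2"
  have "measure_pmf.prob (replicate_pmf (Suc n) P) {zs. t \<le> \<bar>c + sum_list (map g zs)\<bar>}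
    = (\<Sum>z\<in>UNIV. pmf P z * measure_pmf.prob (replicate_pmf n P) {zs. t \<le> \<bar>(c + g z) + sum_list (map g zs)\<bar>})"
    unfolding prob_replicate_Suc by (simp add: add.assoc)
  also have "\<dots> \<le> (\<Sum>z\<in>UNIV. pmf P z * (((c + g z)^2 + n * ?v) / t^2))"
    by (intro sum_mono mult_left_mono Suc.IH) auto
  also have "\<dots> = (\<Sum>z\<in>UNIV. pmf P z * (c^2 + n * ?v) + 2 * c * (pmf P z * g z) + pmf P z * (g z)^2) / t^2"
    by (simp add: sum_divide_distrib power2_sum algebra_simps)
  also have "(\<Sum>z\<in>UNIV. pmf P z * (c^2 + n * ?v) + 2 * c * (pmf P z * g z) + pmf P z * (g z)^2)
      = (c^2 + n * ?v) + 2 * c * (\<Sum>z\<in>UNIV. pmf P z * g z) + ?v"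
    by (simp add: sum.distrib sum_pmf_UNIV sum_distrib_left flip: sum_distrib_right)
  also have "\<dots> = c^2 + Suc n * ?v"
    using g by (simp add: algebra_simps)
  finally show ?case .
qed

text \<open>\<open>2 powr h\<close> acts as a likelihood ratio with mean 1 under \<open>Q\<close>;
  each letter lowers the threshold by \<open>h z\<close>, and averaging restores the same
  bound.\<close>

lemma markov_words:
  fixes Q :: "'a :: finite pmf" and h :: "'a \<Rightarrow> real"
  assumes h: "(\<Sum>z\<in>UNIV. pmf Q z * 2 powr h z) = 1"
  shows "measure_pmf.prob (replicate_pmf n Q) {zs. t \<le> sum_list (map h zs)} \<le> 2 powr - t"
proof (induction n arbitrary: t)
  case 0
  show ?case
    using powr_mono[of 0 "- t" 2] by (auto simp: prob_replicate_0 simp del: replicate_pmf.simps)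
next
  case (Suc n)
  have "measure_pmf.prob (replicate_pmf (Suc n) Q) {zs. t \<le> sum_list (map h zs)}
    = (\<Sum>z\<in>UNIV. pmf Q z * measure_pmf.prob (replicate_pmf n Q) {zs. t - h z \<le> sum_list (map h zs)})"
    unfolding prob_replicate_Suc by (simp add: diff_le_eq add.commute)
  also have "\<dots> \<le> (\<Sum>z\<in>UNIV. pmf Q z * 2 powr - (t - h z))"
    by (intro sum_mono mult_left_mono Suc.IH) auto
  also have "\<dots> = (\<Sum>z\<in>UNIV. pmf Q z * 2 powr h z) * 2 powr - t"
    by (simp add: sum_distrib_right mult.assoc flip: powr_add)
  finally show ?case using h by simp
qed

text \<open>The divergence of \<open>W\<close> is the \<open>W\<close>-mean of the separated
  log-ratio, hence the sum of the means of its two parts under the marginals of \<open>P\<close>.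
  Centring both parts extracts it as the constant.\<close>

lemma minimiser_centred_factorisation:
  fixes P Q W :: "('x :: finite \<times> 'y :: finite) pmf"
  assumes P: "set_pmf P = UNIV" and Q: "set_pmf Q = UNIV"
    and W: "W \<in> same_marginals P" and min: "\<And>V. V \<in> same_marginals P \<Longrightarrow> kl_div W Q \<le> kl_div V Q"
  obtains u :: "'x \<Rightarrow> real" and v :: "'y \<Rightarrow> real"
  where "\<And>z. pmf W z = pmf Q z * 2 powr (kl_div W Q + u (fst z) + v (snd z))"
    and "(\<Sum>x\<in>UNIV. pmf (map_pmf fst P) x * u x) = 0" and "(\<Sum>y\<in>UNIV. pmf (map_pmf snd P) y * v y) = 0"
proof -
  obtain \<phi> :: "'x \<Rightarrow> real" and \<psi> :: "'y \<Rightarrow> real"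
    where fact: "\<And>z. pmf W z = pmf Q z * 2 powr (\<phi> (fst z) + \<psi> (snd z))"
    using minimiser_factorisation[OF P Q W min] by blast
  have Q_pos: "pmf Q z > 0" for z using Q by (auto simp: pmf_positive)
  define a where "a = (\<Sum>x\<in>UNIV. pmf (map_pmf fst P) x * \<phi> x)"
  define b where "b = (\<Sum>y\<in>UNIV. pmf (map_pmf snd P) y * \<psi> y)"
  have log: "log 2 (pmf W z / pmf Q z) = \<phi> (fst z) + \<psi> (snd z)" for z
    using Q_pos[of z] by (simp add: fact)
  have "kl_div W Q = (\<Sum>z\<in>UNIV. pmf W z * (\<phi> (fst z) + \<psi> (snd z)))"
    by (simp only: kl_div_eq_sum[OF Q] log)
  also have "\<dots> = a + b"
    using W by (simp add: sum_pmf_additive a_def b_def same_marginals_def)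
  finally have "kl_div W Q = a + b" .
  then show ?thesis
    by (intro that[of "\<lambda>x. \<phi> x - a" "\<lambda>y. \<psi> y - b"])
      (simp_all add: fact right_diff_distrib sum_subtractf sum_pmf_UNIV a_def b_def flip: sum_distrib_right)
qed

section \<open>Threshold codes and their errors\<close>

lemma prob_replicate_mono:
  assumes "\<And>zs. length zs = n \<Longrightarrow> zs \<in> S \<Longrightarrow> zs \<in> T"
  shows "measure_pmf.prob (replicate_pmf n P) S \<le> measure_pmf.prob (replicate_pmf n P) T"
  using assms by (intro measure_pmf.finite_measure_mono_AE) (auto simp: AE_measure_pmf_iff set_replicate_pmf)

text \<open>Messages start at 1, so node A's constant is 1 and node B's verdict is 1 or 2. Node B
  repeats it in every round to fill any number of rounds; the decision reads the first copy, which
  exists for \<open>K \<ge> 1\<close>.\<close>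

definition threshold_code :: "('x \<Rightarrow> real) \<Rightarrow> ('y \<Rightarrow> real) \<Rightarrow> real \<Rightarrow> ('x, 'y) code" where
  "threshold_code u v \<tau> = \<lparr>fsize = \<lambda>_. 1, gsize = \<lambda>_. 2, fenc = \<lambda>_ _. 1,
     genc = \<lambda>_ (ys, _). if - \<tau> \<le> sum_list (map v ys) then 2 else 1,
     decide = \<lambda>(xs, ms). if - \<tau> \<le> sum_list (map u xs) \<and> ms ! 0 = 2 then 0 else 1\<rparr>"

lemma is_code_threshold_code: "is_code K n (threshold_code u v \<tau>)"
  by (auto simp: is_code_def threshold_code_def)

lemma threshold_transcript:
  "snd (transcript (threshold_code u v \<tau>) xs ys k) = replicate k (if - \<tau> \<le> sum_list (map v ys) then 2 else 1)"
proof (induction k)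
  case (Suc k)
  have "genc (threshold_code u v \<tau>) (Suc k) (ys, fs) = (if - \<tau> \<le> sum_list (map v ys) then 2 else 1)" for fs
    by (simp add: threshold_code_def)
  then show ?case
    using Suc by (simp add: case_prod_unfold Let_def replicate_append_same)
qed simp

lemma decision_threshold_code:
  assumes "K \<ge> 1"
  shows "decision K (threshold_code u v \<tau>) zs
    = (if - \<tau> \<le> sum_list (map (\<lambda>z. u (fst z)) zs) \<and> - \<tau> \<le> sum_list (map (\<lambda>z. v (snd z)) zs) then 0 else 1)"
proof -
  have "decide (threshold_code u v \<tau>) (xs, ms)
    = (if - \<tau> \<le> sum_list (map u xs) \<and> ms ! 0 = 2 then 0 else 1)" for xs ms
    by (simp add: threshold_code_def)
  then show ?thesis
    using assms threshold_transcript[of u v \<tau> "map fst zs" "map snd zs" K]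
    by (simp add: decision_def Let_def comp_def)
qed

lemma zero_rate_threshold_codes: "zero_rate_codes K (\<lambda>n. threshold_code u v (\<tau> n))"
proof -
  have "(\<lambda>n. real K) \<in> o(\<lambda>n. real n)" by real_asymp
  then show ?thesis
    by (simp add: zero_rate_codes_def is_code_threshold_code) (simp add: threshold_code_def)
qed

text \<open>A rejection means that one of the two centred sums deviates by at least
  \<open>\<tau>\<close>; the union bound handles them separately, whatever their correlation under
  \<open>P\<close>.\<close>

lemma type1_error_threshold_code:
  fixes P :: "('x :: finite \<times> 'y :: finite) pmf"
  assumes K: "K \<ge> 1" and \<tau>: "\<tau> > 0"
    and u: "(\<Sum>x\<in>UNIV. pmf (map_pmf fst P) x * u x) = 0" and v: "(\<Sum>y\<in>UNIV. pmf (map_pmf snd P) y * v y) = 0"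
  shows "type1_error K P n (threshold_code u v \<tau>)
    \<le> real n * ((\<Sum>z\<in>UNIV. pmf P z * (u (fst z))^2) + (\<Sum>z\<in>UNIV. pmf P z * (v (snd z))^2)) / \<tau>^2"
proof -
  let ?M = "replicate_pmf n P"
  let ?U = "{zs. \<tau> \<le> \<bar>0 + sum_list (map (\<lambda>z. u (fst z)) zs)\<bar>}"
  let ?V = "{zs. \<tau> \<le> \<bar>0 + sum_list (map (\<lambda>z. v (snd z)) zs)\<bar>}"
  have "type1_error K P n (threshold_code u v \<tau>) \<le> measure_pmf.prob ?M (?U \<union> ?V)"
    unfolding type1_error_def decision_threshold_code[OF K]
    by (intro measure_pmf.finite_measure_mono) (auto split: if_splits)
  also have "\<dots> \<le> measure_pmf.prob ?M ?U + measure_pmf.prob ?M ?V"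
    by (rule measure_Un_le) auto
  also have "\<dots> \<le> (0^2 + real n * (\<Sum>z\<in>UNIV. pmf P z * (u (fst z))^2)) / \<tau>^2
      + (0^2 + real n * (\<Sum>z\<in>UNIV. pmf P z * (v (snd z))^2)) / \<tau>^2"
    using u v \<tau> by (intro add_mono chebyshev_words)
      (simp_all add: sum_map_pmf[of P u fst] sum_map_pmf[of P v snd])
  finally show ?thesis by (simp add: add_divide_distrib distrib_left)
qed

text \<open>If both tests pass, the log-likelihood ratio of \<open>W\<close> to \<open>Q\<close>
  over the word is at least \<open>n * E - 2 * \<tau>\<close>.\<close>

lemma type2_error_threshold_code:
  fixes Q W :: "('x :: finite \<times> 'y :: finite) pmf"
  assumes K: "K \<ge> 1" and W: "\<And>z. pmf W z = pmf Q z * 2 powr (E + u (fst z) + v (snd z))"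
  shows "type2_error K Q n (threshold_code u v \<tau>) \<le> 2 powr - (real n * E - 2 * \<tau>)"
proof -
  let ?h = "\<lambda>z. E + u (fst z) + v (snd z)"
  have sum: "sum_list (map ?h zs) = length zs * E + sum_list (map (\<lambda>z. u (fst z)) zs) + sum_list (map (\<lambda>z. v (snd z)) zs)" for zs
    by (simp add: sum_list_addf sum_list_triv)
  have "type2_error K Q n (threshold_code u v \<tau>)
      \<le> measure_pmf.prob (replicate_pmf n Q) {zs. real n * E - 2 * \<tau> \<le> sum_list (map ?h zs)}"
    unfolding type2_error_def decision_threshold_code[OF K]
    by (intro prob_replicate_mono) (auto simp: sum split: if_splits)
  also have "\<dots> \<le> 2 powr - (real n * E - 2 * \<tau>)"
    by (rule markov_words) (simp add: sum_pmf_UNIV flip: W)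
  finally show ?thesis .
qed

lemma achievability:
  fixes P Q W :: "('x :: finite \<times> 'y :: finite) pmf"
  assumes P: "set_pmf P = UNIV" and Q: "set_pmf Q = UNIV" and K: "K \<ge> 1" and \<epsilon>: "0 < \<epsilon>"
    and W: "W \<in> same_marginals P" and min: "\<And>V. V \<in> same_marginals P \<Longrightarrow> kl_div W Q \<le> kl_div V Q"
  shows "\<exists>C. zero_rate_codes K C \<and> (\<forall>\<^sub>F n in sequentially. type1_error K P n (C n) \<le> \<epsilon>) \<and>
    ereal (kl_div W Q) \<le> liminf (\<lambda>n. error_exponent n (type2_error K Q n (C n)))"
proof -
  obtain u v where uv: "\<And>z. pmf W z = pmf Q z * 2 powr (kl_div W Q + u (fst z) + v (snd z))"
    "(\<Sum>x\<in>UNIV. pmf (map_pmf fst P) x * u x) = 0" "(\<Sum>y\<in>UNIV. pmf (map_pmf snd P) y * v y) = 0"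
    using minimiser_centred_factorisation[OF P Q W min] by blast
  \<comment> \<open>Any exponent strictly between 1/2 and 1 would do: \<open>n / \<tau>^2\<close>
    must vanish for the first error and \<open>\<tau> / n\<close> for the exponent of the
    second.\<close>
  define \<tau> where "\<tau> n = real n powr (2/3)" for n
  define C where "C n = threshold_code u v (\<tau> n)" for n
  define \<sigma> where "\<sigma> = (\<Sum>z\<in>UNIV. pmf P z * (u (fst z))^2) + (\<Sum>z\<in>UNIV. pmf P z * (v (snd z))^2)"
  have "(\<lambda>n. real n * \<sigma> / \<tau> n ^ 2) \<longlonglongrightarrow> 0"
    unfolding \<tau>_def by real_asymp
  then have "\<forall>\<^sub>F n in sequentially. real n * \<sigma> / \<tau> n ^ 2 < \<epsilon>"
    using \<epsilon> by (rule order_tendstoD)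
  then have "\<forall>\<^sub>F n in sequentially. type1_error K P n (C n) \<le> \<epsilon>"
    using eventually_gt_at_top[of 0]
  proof eventually_elim
    case (elim n)
    then show ?case
      using type1_error_threshold_code[OF K _ uv(2,3), of "\<tau> n" n]
      by (simp add: C_def \<sigma>_def \<tau>_def)
  qed
  moreover have "zero_rate_codes K C"
    unfolding C_def by (rule zero_rate_threshold_codes)
  moreover have "ereal (kl_div W Q) \<le> liminf (\<lambda>n. error_exponent n (type2_error K Q n (C n)))"
  proof -
    have "(\<lambda>n. kl_div W Q - 2 * (\<tau> n / real n)) \<longlonglongrightarrow> kl_div W Q - 2 * 0"
      unfolding \<tau>_def by (intro tendsto_intros) real_asymp
    then have "liminf (\<lambda>n. ereal (kl_div W Q - 2 * (\<tau> n / real n))) = ereal (kl_div W Q)"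
      by (intro lim_imp_Liminf) auto
    moreover have "\<forall>\<^sub>F n in sequentially. ereal (kl_div W Q - 2 * (\<tau> n / real n))
        \<le> error_exponent n (type2_error K Q n (C n))"
      using eventually_gt_at_top[of 0]
    proof eventually_elim
      case (elim n)
      let ?\<beta> = "type2_error K Q n (C n)"
      have le: "?\<beta> \<le> 2 powr - (real n * kl_div W Q - 2 * \<tau> n)"
        unfolding C_def by (rule type2_error_threshold_code[OF K uv(1)])
      show ?case
      proof (cases "?\<beta> = 0")
        case False
        then have "?\<beta> > 0" by (simp add: type2_error_def zero_less_measure_iff)
        then have "log 2 ?\<beta> \<le> log 2 (2 powr - (real n * kl_div W Q - 2 * \<tau> n))"
          using le by (intro log_mono) auto
        then have "(real n * kl_div W Q - 2 * \<tau> n) / real n \<le> - log 2 ?\<beta> / real n"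
          by (intro divide_right_mono) auto
        then have "kl_div W Q - 2 * (\<tau> n / real n) \<le> - (1 / real n) * log 2 ?\<beta>"
          using elim by (simp add: diff_divide_distrib)
        then show ?thesis using False by (simp add: error_exponent_def)
      qed (simp add: error_exponent_def)
    qed
    ultimately show ?thesis using Liminf_mono by fastforce
  qed
  ultimately show ?thesis by blast
qed

theorem theorem2:
  fixes P Q :: "('x :: finite \<times> 'y :: finite) pmf" and K :: nat and \<epsilon> :: real
  assumes "set_pmf P = UNIV" and "set_pmf Q = UNIV"
    and "K \<ge> 1" and "0 < \<epsilon>" and "\<epsilon> < 1"
  shows "\<exists>W. is_arg_min (\<lambda>W. kl_div W Q) (\<lambda>W. W \<in> same_marginals P) W \<and>
             optimal_zero_rate_exponent P Q K \<epsilon> (ereal (kl_div W Q))"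
proof -
  obtain W where arg_min: "is_arg_min (\<lambda>W. kl_div W Q) (\<lambda>W. W \<in> same_marginals P) W"
    using kl_div_minimiser_exists[OF assms(2)] by blast
  then have W: "W \<in> same_marginals P"
    and min: "\<And>V. V \<in> same_marginals P \<Longrightarrow> kl_div W Q \<le> kl_div V Q"
    by (auto simp: is_arg_min_def not_less)
  note upper = converse[OF assms(1,2,5) W]
  obtain C where C: "zero_rate_codes K C" "\<forall>\<^sub>F n in sequentially. type1_error K P n (C n) \<le> \<epsilon>"
    and lower: "ereal (kl_div W Q) \<le> liminf (\<lambda>n. error_exponent n (type2_error K Q n (C n)))"
    using achievability[OF assms(1-4) W min] by blast
  \<comment> \<open>The converse applied to the achieving codes themselves turns their lower bound
    into a limit.\<close>
  have "(\<lambda>n. error_exponent n (type2_error K Q n (C n))) \<longlonglongrightarrow> ereal (kl_div W Q)"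
    using lower upper[OF C] Liminf_le_Limsup[of sequentially "\<lambda>n. error_exponent n (type2_error K Q n (C n))"]
    by (simp add: tendsto_iff_Liminf_eq_Limsup) (metis antisym order_trans)
  then show ?thesis
    using arg_min C upper unfolding optimal_zero_rate_exponent_def by blast
qed

end
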